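(* Let $n\ge 2$, let $A,B\subset\mathbb{R}^n$ be convex bodies, and fix an integer $1\le i\le n$. If for every fractional linear map $F$ on $\mathbb{R}^n$ that is admissible for $A$ and $B$ (i.e. $A,B\subset \mathrm{Dom}(F)$) one has $$W_{n-i}(F(A))\le W_{n-i}(F(B)),$$ then $A\subseteq B$.
   Context: A convex body in $\mathbb{R}^n$ is a compact convex set with non-empty interior. A fractional linear map on $\mathbb{R}^n$ is a map of the form $F(x)=\frac{Mx+b}{\langle x,c\rangle+d}$, where $M$ is a linear operator on $\mathbb{R}^n$, $b,c\in\mathbb{R}^n$, $d\in\mathbb{R}$, and the $(n+1)\times(n+1)$ matrix $\begin{pmatrix} M & b\\ c & d\end{pmatrix}$ is invertible. If $c=0$ the map is affine and $\mathrm{Dom}(F)=\mathbb{R}^n$. If $c\neq 0$, the map is undefined on the affine hyperplane $H=\{x:\langle x,c\rangle+d=0\}$, and $F$ is considered on one side of $H$, i.e. $\mathrm{Dom}(F)$ is one of the two open half-spaces bounded by $H$. The map $F$ is admissible for $A,B$ if $A,B\subset\mathrm{Dom}(F)$. $W_{n-i}$ is the quermassintegral $W_{n-i}(K)=V(K[i],D_n[n-i])$, where $V$ is the $n$-dimensional mixed volume, $D_n$ is the Euclidean unit ball of $\mathbb{R}^n$, and $K[j]$ denotes $j$ copies of $K$. *)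

theory Defs
  imports "HOL-Analysis.Analysis"
begin

definition convex_body :: "'a::euclidean_space set \<Rightarrow> bool" where
  "convex_body K \<longleftrightarrow> compact K \<and> convex K \<and> interior K \<noteq> {}"

(* V is symmetric and its values are the coefficients of the volume polynomial
     vol (l_0 K_0 + ... + l_(m-1) K_(m-1))
       = SUM over (j_1,...,j_n) in {0..<m}^n of l_(j_1) ... l_(j_n) V(K_(j_1),...,K_(j_n)),
   with n = DIM('a) and l_j >= 0. The sum of sets is the Minkowski sum of
   HOL-Library.Set_Algebras, whose empty case is {0}. *)
definition mixed_volume_functional :: "('a::euclidean_space set list \<Rightarrow> real) \<Rightarrow> bool" where
  "mixed_volume_functional V \<longleftrightarrow>
     (\<forall>Ks Ls. length Ks = DIM('a) \<and> (\<forall>K\<in>set Ks. convex_body K) \<and> mset Ls = mset Ks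
        \<longrightarrow> V Ls = V Ks) \<and>
     (\<forall>(m::nat) (K :: nat \<Rightarrow> 'a set) (l :: nat \<Rightarrow> real).
        (\<forall>j<m. convex_body (K j)) \<and> (\<forall>j<m. 0 \<le> l j) \<longrightarrow>
        measure lebesgue (\<Sum>j<m. (\<lambda>x. l j *\<^sub>R x) ` K j) =
          (\<Sum>js | set js \<subseteq> {..<m} \<and> length js = DIM('a).
             prod_list (map l js) * V (map K js)))"

(* By Minkowski's theorem such a V exists, and it is unique on n-tuples of convex
   bodies, so the choice only affects arguments that are not such tuples. *)
definition mixed_volume :: "'a::euclidean_space set list \<Rightarrow> real" where
  "mixed_volume = (SOME V. mixed_volume_functional V)"

definition quermassintegral :: "nat \<Rightarrow> 'a::euclidean_space set \<Rightarrow> real" where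
  "quermassintegral k K =
     mixed_volume (replicate (DIM('a) - k) K @ replicate k (cball 0 1))"

(* The (n+1) x (n+1) matrix with rows (M b) and (c d); the extra index is None. *)
definition block_matrix ::
    "real^'n^'n \<Rightarrow> real^'n \<Rightarrow> real^'n \<Rightarrow> real \<Rightarrow> real^('n option)^('n option)" where
  "block_matrix M b c d =
     (\<chi> i j. case i of
        Some i' \<Rightarrow> (case j of Some j' \<Rightarrow> M $ i' $ j' | None \<Rightarrow> b $ i')
      | None \<Rightarrow> (case j of Some j' \<Rightarrow> c $ j' | None \<Rightarrow> d))"

(* F is only constrained on its domain D, one of the two sides of the singular hyperplane
   (or the whole space if c = 0). *)
definition fractional_linear_map ::
    "(real^'n) set \<Rightarrow> (real^'n \<Rightarrow> real^'n) \<Rightarrow> bool" where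
  "fractional_linear_map D F \<longleftrightarrow>
     (\<exists>M b c d. invertible (block_matrix M b c d) \<and>
        (if c = 0 then D = UNIV
         else D = {x. x \<bullet> c + d > 0} \<or> D = {x. x \<bullet> c + d < 0}) \<and>
        (\<forall>x\<in>D. F x = (M *v x + b) /\<^sub>R (x \<bullet> c + d)))"

end

theory Submission
  imports Defs
begin

text \<open>
  Minkowski's theorem is proved by transport. For a convex body \<open>K\<close> take point masses \<open>w k > 0\<close> at a
  dense sequence \<open>v k\<close> in \<open>K\<close>; the potential \<open>x \<mapsto> ln (\<Sum>k. w k * exp (x \<bullet> v k))\<close> is smooth and strictly
  convex, and its recession function is the support function of \<open>K\<close>. Hence for \<open>l j \<ge> 0\<close>, not all
  zero, the gradient of \<open>\<Sum>j. l j * p j\<close> is injective with image between the interior of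
  \<open>\<Sum>j. l j * K j\<close> and that body, and the change of variables formula yields the volume as the integral
  of \<open>det (\<Sum>j. l j * H j)\<close>, \<open>H j\<close> being the Hessians. Expanding the determinant shows that mixed
  volumes are integrals of mixed discriminants of covariance matrices, which are nonnegative.

  Monotonicity for \<open>K \<subseteq> L\<close>: masses on \<open>K\<close> plus \<open>t\<close> times masses on \<open>L\<close> represent \<open>L\<close> for every \<open>t > 0\<close>.
  As \<open>t\<close> tends to 0 the Hessians converge to those of \<open>K\<close>, and Fatou's lemma compares the integrals.

  If \<open>A\<close> is not contained in \<open>B\<close>, some supporting hyperplane of \<open>A\<close> misses \<open>B\<close>. Moving the singular
  hyperplane of a fractional linear map towards it keeps the image of \<open>B\<close> in a fixed ball, while the
  image of the cone spanned by the contact point and a ball in \<open>A\<close> contains cylinders of fixed radius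
  and unbounded length, so by monotonicity the quermassintegral of the image of \<open>A\<close> is unbounded.
\<close>

subsection \<open>Mixed discriminants\<close>

text \<open>\<open>mixed_volume\<close> is a choice among functionals known only through the volume
  polynomial, so every fact about it has to be read off that polynomial. For two bodies the
  coefficients in one parameter determine the mixed volumes; hence every such functional agrees with
  the integral of mixed discriminants, whatever gradient maps are taken. This freedom drives the
  monotonicity argument: the potentials for \<open>L\<close> may vary with \<open>t\<close> while
  their integral stays constant, and only the passage to \<open>t = 0\<close> loses something. Mixed
  volumes of balls are never computed: monotonicity holds in both slots, so the unit ball is
  replaced from below by a cube, and the only explicit values are those of a coordinate box and a
  cube. This is why the direction \<open>e\<close> in which images are stretched is taken along a
  coordinate axis.\<close>

abbreviation slot_bijections :: "('n::finite \<Rightarrow> nat) set" where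
  "slot_bijections \<equiv> {\<sigma>. bij_betw \<sigma> UNIV {..<CARD('n)}}"

text \<open>The polarisation of \<open>det\<close>: row \<open>r\<close> is taken from the matrix in
  slot \<open>\<sigma> r\<close>, averaged over all bijections of rows with slots. Slots are
  numbered to match the index lists of the volume polynomial.\<close>

definition mixed_discriminant :: "(real^'n^'n) list \<Rightarrow> real" where
  "mixed_discriminant As =
     (\<Sum>\<sigma>\<in>slot_bijections. det (\<chi> r. (As ! \<sigma> r) $ r)) / card (slot_bijections :: ('n \<Rightarrow> nat) set)"

lemma finite_slot_bijections: "finite (slot_bijections :: ('n::finite \<Rightarrow> nat) set)"
proof -
  have "slot_bijections \<subseteq> PiE (UNIV :: 'n set) (\<lambda>_. {..<CARD('n)})"
    by (auto simp: bij_betw_def)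
  then show ?thesis
    by (rule finite_subset) (simp add: finite_PiE)
qed

lemma card_slot_bijections_pos: "0 < card (slot_bijections :: ('n::finite \<Rightarrow> nat) set)"
proof -
  obtain \<sigma> :: "'n \<Rightarrow> nat" where "bij_betw \<sigma> UNIV {..<CARD('n)}"
    using finite_same_card_bij[of "UNIV :: 'n set" "{..<CARD('n)}"] by auto
  then show ?thesis
    using finite_slot_bijections by (auto simp: card_gt_0_iff)
qed

lemma mixed_discriminant_permute:
  fixes As Bs :: "(real^'n^'n) list"
  assumes "length As = CARD('n)" "mset Bs = mset As"
  shows "mixed_discriminant Bs = mixed_discriminant As"
proof -
  obtain p where p: "p permutes {..<length As}" "permute_list p As = Bs"
    using mset_eq_permutation[OF assms(2)] by blast
  have "(\<Sum>\<sigma>\<in>slot_bijections. det (\<chi> r. (Bs ! \<sigma> r) $ r)) =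
        (\<Sum>\<sigma>\<in>slot_bijections. det (\<chi> r. (As ! \<sigma> r) $ r))"
  proof (rule sum.reindex_bij_witness[where i = "\<lambda>\<sigma>. inv p \<circ> \<sigma>" and j = "\<lambda>\<sigma>. p \<circ> \<sigma>"])
    fix \<sigma> :: "'n \<Rightarrow> nat"
    assume s: "\<sigma> \<in> slot_bijections"
    have bp: "bij_betw p {..<CARD('n)} {..<CARD('n)}"
      using p(1) assms(1) by (simp add: permutes_imp_bij)
    have bip: "bij_betw (inv p) {..<CARD('n)} {..<CARD('n)}"
      using permutes_imp_bij[OF permutes_inv[OF p(1)]] assms(1) by simp
    show "inv p \<circ> (p \<circ> \<sigma>) = \<sigma>" "p \<circ> (inv p \<circ> \<sigma>) = \<sigma>"
      using permutes_inv_o[OF p(1)] by (simp_all add: o_assoc)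
    show "p \<circ> \<sigma> \<in> slot_bijections" "inv p \<circ> \<sigma> \<in> slot_bijections"
      using s bp bip by (auto intro: bij_betw_trans)
    have "Bs ! \<sigma> r = As ! (p \<circ> \<sigma>) r" for r
    proof -
      have "\<sigma> r < length As"
        using s assms(1) by (auto simp: bij_betw_def)
      then have "permute_list p As ! \<sigma> r = As ! p (\<sigma> r)"
        by (rule permute_list_nth[OF p(1)])
      then show ?thesis
        by (simp add: p(2))
    qed
    then show "det (\<chi> r. (As ! (p \<circ> \<sigma>) r) $ r) = det (\<chi> r. (Bs ! \<sigma> r) $ r)"
      by simp
  qed
  then show ?thesis
    by (simp add: mixed_discriminant_def)
qed

lemma det_rows_sum:
  fixes a :: "'n::finite \<Rightarrow> 'j \<Rightarrow> 'a::comm_ring_1^'n"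
  assumes "finite S"
  shows "det (\<chi> r. \<Sum>j\<in>S. a r j) = (\<Sum>f | \<forall>r. f r \<in> S. det (\<chi> r. a r (f r)))"
proof -
  have "PiE UNIV (\<lambda>_::'n. S) = {f. \<forall>r. f r \<in> S}"
    by (auto simp: PiE_UNIV_domain)
  then have "(\<Prod>r\<in>UNIV. \<Sum>j\<in>S. a r j $ p r) = (\<Sum>f | \<forall>r. f r \<in> S. \<Prod>r\<in>UNIV. a r (f r) $ p r)" for p
    using prod_sum_PiE[of UNIV "\<lambda>_. S" "\<lambda>r j. a r j $ p r"] assms by simp
  then show ?thesis
    unfolding det_def by (simp add: sum_component sum_distrib_left) (rule sum.swap)
qed

text \<open>For a fixed bijection \<open>\<sigma>\<close>, reading \<open>js ! \<sigma> r\<close>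
  turns index lists into row choices one to one, so the sum over lists is already the full row
  expansion of the determinant. Averaging over \<open>\<sigma>\<close> then changes nothing.\<close>

lemma det_sum_eq_mixed_discriminants:
  fixes A :: "nat \<Rightarrow> real^'n^'n" and l :: "nat \<Rightarrow> real"
  shows "det (\<Sum>j<m. l j *\<^sub>R A j) =
    (\<Sum>js | set js \<subseteq> {..<m} \<and> length js = CARD('n).
       prod_list (map l js) * mixed_discriminant (map A js))"
proof -
  let ?L = "{js. set js \<subseteq> {..<m} \<and> length js = CARD('n)}"
  let ?F = "{f :: 'n \<Rightarrow> nat. \<forall>i. f i \<in> {..<m}}"
  let ?B = "slot_bijections :: ('n \<Rightarrow> nat) set"
  have "(\<Sum>j<m. l j *\<^sub>R A j) = (\<chi> r. \<Sum>j<m. l j *s (A j $ r))"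
    by (simp add: vec_eq_iff sum_component)
  then have "det (\<Sum>j<m. l j *\<^sub>R A j) = (\<Sum>f\<in>?F. det (\<chi> r. l (f r) *s (A (f r) $ r)))"
    using det_rows_sum[of "{..<m}" "\<lambda>r j. l j *s (A j $ r)"] by simp
  also have "\<dots> = (\<Sum>f\<in>?F. (\<Prod>r\<in>UNIV. l (f r)) * det (\<chi> r. A (f r) $ r))"
    by (simp add: det_rows_mul)
  finally have det: "det (\<Sum>j<m. l j *\<^sub>R A j) =
    (\<Sum>f\<in>?F. (\<Prod>r\<in>UNIV. l (f r)) * det (\<chi> r. A (f r) $ r))" .
  have slot: "(\<Sum>js\<in>?L. prod_list (map l js) * det (\<chi> r. (map A js ! \<sigma> r) $ r)) =
      (\<Sum>f\<in>?F. (\<Prod>r\<in>UNIV. l (f r)) * det (\<chi> r. A (f r) $ r))"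
    if s: "\<sigma> \<in> ?B" for \<sigma>
  proof (rule sum.reindex_bij_witness
      [where i = "\<lambda>f. map (f \<circ> inv_into UNIV \<sigma>) [0..<CARD('n)]" and j = "\<lambda>js r. js ! \<sigma> r"])
    have s': "\<sigma> r < CARD('n)" "inv_into UNIV \<sigma> (\<sigma> r) = r" for r
      using s by (auto simp: bij_betw_def)
    have s'': "\<sigma> (inv_into UNIV \<sigma> j) = j" if "j < CARD('n)" for j
      using s that by (auto simp: bij_betw_def f_inv_into_f)
    fix js assume js: "js \<in> ?L"
    show "map ((\<lambda>r. js ! \<sigma> r) \<circ> inv_into UNIV \<sigma>) [0..<CARD('n)] = js"
      using js s'' by (auto simp: list_eq_iff_nth_eq)
    show "(\<lambda>r. js ! \<sigma> r) \<in> ?F"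
    proof -
      have "js ! \<sigma> r \<in> set js" for r
        using js s'(1) by (intro nth_mem) auto
      then show ?thesis
        using js by auto
    qed
    have "prod_list (map l js) = (\<Prod>j<CARD('n). l (js ! j))"
      using js by (simp add: prod.list_conv_set_nth atLeast0LessThan)
    also have "\<dots> = (\<Prod>r\<in>UNIV. l (js ! \<sigma> r))"
      using s by (simp add: prod.reindex_bij_betw[of \<sigma> UNIV, symmetric])
    finally show "(\<Prod>r\<in>UNIV. l (js ! \<sigma> r)) * det (\<chi> r. A (js ! \<sigma> r) $ r) =
      prod_list (map l js) * det (\<chi> r. (map A js ! \<sigma> r) $ r)"
      using js s' by simp
  next
    have s': "\<sigma> r < CARD('n)" "inv_into UNIV \<sigma> (\<sigma> r) = r" for r
      using s by (auto simp: bij_betw_def)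
    fix f assume f: "f \<in> ?F"
    show "(\<lambda>r. map (f \<circ> inv_into UNIV \<sigma>) [0..<CARD('n)] ! \<sigma> r) = f"
      using s' by auto
    show "map (f \<circ> inv_into UNIV \<sigma>) [0..<CARD('n)] \<in> ?L"
      using f by auto
  qed
  have "(\<Sum>js\<in>?L. prod_list (map l js) * mixed_discriminant (map A js)) =
      (\<Sum>\<sigma>\<in>?B. \<Sum>js\<in>?L. prod_list (map l js) * det (\<chi> r. (map A js ! \<sigma> r) $ r)) / card ?B"
    unfolding mixed_discriminant_def sum_divide_distrib sum_distrib_left
    by (subst sum.swap) simp
  also have "\<dots> = (\<Sum>\<sigma>\<in>?B. det (\<Sum>j<m. l j *\<^sub>R A j)) / card ?B"
    by (simp only: slot det cong: sum.cong)
  also have "\<dots> = det (\<Sum>j<m. l j *\<^sub>R A j)"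
    using card_slot_bijections_pos[where 'n='n] by simp
  finally show ?thesis ..
qed

definition outer :: "real^'n \<Rightarrow> real^'n^'n" where
  "outer a = (\<chi> r c. a $ r * a $ c)"

text \<open>The bijections act as permutations of the rows of \<open>b\<close>. Each term is a
  product of entries of \<open>b\<close> times a signed \<open>det b\<close>, and the signed
  products sum to \<open>det b\<close> once more, so the sum is the square of
  \<open>det b\<close>.\<close>

lemma mixed_discriminant_outer_nonneg:
  fixes As :: "(real^'n^'n) list"
  assumes "\<And>j. j < CARD('n) \<Longrightarrow> As ! j = outer (a j)"
  shows "0 \<le> mixed_discriminant As"
proof -
  let ?B = "slot_bijections :: ('n \<Rightarrow> nat) set"
  obtain \<tau> :: "'n \<Rightarrow> nat" where t: "bij_betw \<tau> UNIV {..<CARD('n)}"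
    using finite_same_card_bij[of "UNIV :: 'n set" "{..<CARD('n)}"] by auto
  define b where "b = (\<chi> r. a (\<tau> r))"
  have "(\<Sum>\<sigma>\<in>?B. det (\<chi> r. (As ! \<sigma> r) $ r)) =
    (\<Sum>p | p permutes UNIV. det (\<chi> r. (b $ p r $ r) *s b $ p r))"
  proof (rule sum.reindex_bij_witness[where i = "\<lambda>p. \<tau> \<circ> p" and j = "\<lambda>\<sigma>. inv_into UNIV \<tau> \<circ> \<sigma>"])
    have t': "\<tau> r < CARD('n)" "inv_into UNIV \<tau> (\<tau> r) = r" for r
      using t by (auto simp: bij_betw_def)
    have t'': "\<tau> (inv_into UNIV \<tau> j) = j" if "j < CARD('n)" for j
      using t that by (auto simp: bij_betw_def f_inv_into_f)
    fix \<sigma> :: "'n \<Rightarrow> nat" assume s: "\<sigma> \<in> ?B"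
    have s': "\<sigma> r < CARD('n)" for r
      using s by (auto simp: bij_betw_def)
    show "\<tau> \<circ> (inv_into UNIV \<tau> \<circ> \<sigma>) = \<sigma>"
      using t'' s' by auto
    show "inv_into UNIV \<tau> \<circ> \<sigma> \<in> {p. p permutes UNIV}"
      using bij_betw_trans[OF _ bij_betw_inv_into[OF t], of \<sigma> UNIV] s bij_imp_permutes by blast
    have "(As ! \<sigma> r) $ r = b $ (inv_into UNIV \<tau> \<circ> \<sigma>) r $ r *s b $ (inv_into UNIV \<tau> \<circ> \<sigma>) r" for r
      using s' t'' by (simp add: assms outer_def b_def vec_eq_iff)
    then show "det (\<chi> r. b $ (inv_into UNIV \<tau> \<circ> \<sigma>) r $ r *s b $ (inv_into UNIV \<tau> \<circ> \<sigma>) r) =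
        det (\<chi> r. (As ! \<sigma> r) $ r)"
      by simp
  next
    fix p :: "'n \<Rightarrow> 'n" assume p: "p \<in> {p. p permutes UNIV}"
    show "inv_into UNIV \<tau> \<circ> (\<tau> \<circ> p) = p"
      using t by (auto simp: bij_betw_def)
    show "\<tau> \<circ> p \<in> ?B"
      using bij_betw_trans[OF permutes_imp_bij t] p by auto
  qed
  also have "\<dots> = (\<Sum>p | p permutes UNIV. (\<Prod>r\<in>UNIV. b $ p r $ r) * (of_int (sign p) * det b))"
  proof (rule sum.cong[OF refl])
    fix p :: "'n \<Rightarrow> 'n" assume p: "p \<in> {p. p permutes UNIV}"
    then have "det (\<chi> r. b $ p r) = of_int (sign p) * det b"
      using det_permute_rows[of p b] by simp
    then show "det (\<chi> r. (b $ p r $ r) *s b $ p r) =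
        (\<Prod>r\<in>UNIV. b $ p r $ r) * (of_int (sign p) * det b)"
      by (simp add: det_rows_mul)
  qed
  also have "\<dots> = det (transpose b) * det b"
    unfolding det_def[of "transpose b"] by (simp add: sum_distrib_left transpose_def ac_simps)
  finally have "(\<Sum>\<sigma>\<in>?B. det (\<chi> r. (As ! \<sigma> r) $ r)) = det b * det b"
    by simp
  then show ?thesis
    by (simp add: mixed_discriminant_def)
qed

text \<open>The bidual cone of the rank one matrices; membership is tested by linear functionals, which
  pass through infinite series.\<close>
definition psd_cone :: "(real^'n^'n) set" where
  "psd_cone = {A. \<forall>f :: real^'n^'n \<Rightarrow> real. linear f \<longrightarrow> (\<forall>a. 0 \<le> f (outer a)) \<longrightarrow> 0 \<le> f A}"

text \<open>For each bijection exactly one row \<open>r0\<close> uses slot \<open>k\<close>, so each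
  determinant depends on the matrix there through a single row.\<close>

lemma linear_mixed_discriminant_slot:
  fixes As :: "(real^'n^'n) list"
  assumes "length As = CARD('n)" "k < CARD('n)"
  shows "linear (\<lambda>A. mixed_discriminant (As[k := A]))"
proof -
  have lin: "linear (\<lambda>A. det (\<chi> r. (As[k := A] ! \<sigma> r) $ r))" if s: "\<sigma> \<in> slot_bijections" for \<sigma> :: "'n \<Rightarrow> nat"
  proof -
    obtain r0 where r0: "\<sigma> r0 = k"
      using s assms(2) by (metis (mono_tags, lifting) bij_betw_iff_bijections lessThan_iff mem_Collect_eq)
    have r: "\<sigma> r = k \<longleftrightarrow> r = r0" for r
      using s r0 by (auto simp: bij_betw_def inj_on_def)
    have "(As[k := A] ! \<sigma> r) $ r = (if r = r0 then A $ r else (As ! \<sigma> r) $ r)" for A r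
      using r[of r] assms by (cases "\<sigma> r = k") auto
    then have eq: "(\<chi> r. (As[k := A] ! \<sigma> r) $ r) = (\<chi> r. if r = r0 then A $ r else (As ! \<sigma> r) $ r)" for A
      by simp
    show ?thesis
      unfolding eq
    proof (rule linearI)
      fix A B :: "real^'n^'n" and c :: real
      show "det (\<chi> r. if r = r0 then (A + B) $ r else (As ! \<sigma> r) $ r) =
        det (\<chi> r. if r = r0 then A $ r else (As ! \<sigma> r) $ r) +
        det (\<chi> r. if r = r0 then B $ r else (As ! \<sigma> r) $ r)"
        using det_row_add[of r0 "\<lambda>r. A $ r" "\<lambda>r. B $ r" "\<lambda>r. (As ! \<sigma> r) $ r"]
        by (simp cong: if_cong)
      show "det (\<chi> r. if r = r0 then (c *\<^sub>R A) $ r else (As ! \<sigma> r) $ r) =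
        c *\<^sub>R det (\<chi> r. if r = r0 then A $ r else (As ! \<sigma> r) $ r)"
        using det_row_mul[of r0 c "\<lambda>r. A $ r" "\<lambda>r. (As ! \<sigma> r) $ r"]
        by (simp add: scalar_mult_eq_scaleR cong: if_cong)
    qed
  qed
  have "linear (\<lambda>A. inverse (real (card (slot_bijections :: ('n \<Rightarrow> nat) set))) *
      (\<Sum>\<sigma>\<in>slot_bijections. det (\<chi> r. (As[k := A] ! \<sigma> r) $ r)))"
    using linear_compose_scale_right[OF linear_compose_sum[of slot_bijections
          "\<lambda>\<sigma> A. det (\<chi> r. (As[k := A] ! \<sigma> r) $ r)"]] lin
    unfolding real_scaleR_def by blast
  then show ?thesis
    by (simp add: mixed_discriminant_def divide_inverse mult.commute)
qed

text \<open>The slots are freed one at a time. In slot \<open>k\<close> the induction hypothesis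
  gives nonnegativity at all rank one matrices, and linearity makes the mixed discriminant one of
  the functionals that test membership in \<open>psd_cone\<close>.\<close>

lemma mixed_discriminant_nonneg:
  fixes As :: "(real^'n^'n) list"
  assumes len: "length As = CARD('n)" and psd: "set As \<subseteq> psd_cone"
  shows "0 \<le> mixed_discriminant As"
proof -
  have "0 \<le> mixed_discriminant As"
    if "k \<le> CARD('n)" "length As = CARD('n)" "\<forall>j<k. As ! j \<in> psd_cone"
      "\<forall>j<CARD('n). k \<le> j \<longrightarrow> (\<exists>a. As ! j = outer a)" for k and As :: "(real^'n^'n) list"
    using that
  proof (induction k arbitrary: As)
    case 0
    then have "\<forall>j. \<exists>a. j < CARD('n) \<longrightarrow> As ! j = outer a"
      by blast
    then obtain a where "\<And>j. j < CARD('n) \<Longrightarrow> As ! j = outer (a j)"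
      by metis
    then show ?case
      by (rule mixed_discriminant_outer_nonneg)
  next
    case (Suc k)
    have "0 \<le> mixed_discriminant (As[k := outer a])" for a
      using Suc.prems by (intro Suc.IH) (auto simp: nth_list_update)
    moreover have "linear (\<lambda>A. mixed_discriminant (As[k := A]))"
      using Suc.prems by (intro linear_mixed_discriminant_slot) auto
    ultimately have "0 \<le> mixed_discriminant (As[k := As ! k])"
      using Suc.prems(3) unfolding psd_cone_def by blast
    then show ?case by simp
  qed
  from this[of "CARD('n)" As] show ?thesis
    using assms by (auto simp: subset_iff)
qed

subsection \<open>Exponential moments of discrete measures\<close>

text \<open>With \<open>c = 1\<close> this is the Laplace transform of the masses \<open>w k\<close>
  at \<open>v k\<close>. Allowing vector coefficients makes every directional derivative another
  function of the same kind.\<close>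

definition exp_moment ::
    "(nat \<Rightarrow> 'a::euclidean_space) \<Rightarrow> (nat \<Rightarrow> real) \<Rightarrow> (nat \<Rightarrow> 'b::banach) \<Rightarrow> 'a \<Rightarrow> 'b" where
  "exp_moment v w c x = (\<Sum>k. (w k * exp (x \<bullet> v k)) *\<^sub>R c k)"

lemma exp_moment_term_bound:
  assumes w: "0 \<le> w k" and v: "norm (v k) \<le> R" and c: "norm (c k) \<le> C" and x: "norm x \<le> r"
  shows "norm ((w k * exp (x \<bullet> v k)) *\<^sub>R c k) \<le> exp (r * R) * C * w k"
proof -
  have "0 \<le> R" "0 \<le> C" "0 \<le> r"
    using order_trans[OF norm_ge_zero v] order_trans[OF norm_ge_zero c] order_trans[OF norm_ge_zero x]
    by simp_all
  have "x \<bullet> v k \<le> norm x * norm (v k)"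
    by (rule norm_cauchy_schwarz)
  also have "\<dots> \<le> r * R"
    using v x \<open>0 \<le> r\<close> by (intro mult_mono) auto
  finally have "exp (x \<bullet> v k) \<le> exp (r * R)"
    by simp
  then have "exp (x \<bullet> v k) * norm (c k) \<le> exp (r * R) * C"
    using c by (intro mult_mono) auto
  then have "w k * (exp (x \<bullet> v k) * norm (c k)) \<le> w k * (exp (r * R) * C)"
    using w by (rule mult_left_mono)
  then show ?thesis
    using w by (simp add: abs_mult mult.assoc mult.commute mult.left_commute)
qed

lemma exp_moment_summable_norm:
  assumes "\<And>k. 0 \<le> w k" "summable w" "bounded (range v)" "bounded (range c)"
  shows "summable (\<lambda>k. norm ((w k * exp (x \<bullet> v k)) *\<^sub>R c k))"
proof -
  obtain R C where R: "\<And>k. norm (v k) \<le> R" and C: "\<And>k. norm (c k) \<le> C"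
    using assms(3,4) by (auto simp: bounded_iff)
  show ?thesis
  proof (rule summable_comparison_test'[OF summable_mult[OF assms(2)]])
    show "norm (norm ((w k * exp (x \<bullet> v k)) *\<^sub>R c k)) \<le> exp (norm x * R) * C * w k" for k
      using exp_moment_term_bound[of w k v R c C x "norm x", OF assms(1) R C order_refl] by simp
  qed
qed

lemma exp_moment_sums:
  assumes "\<And>k. 0 \<le> w k" "summable w" "bounded (range v)" "bounded (range c)"
  shows "(\<lambda>k. (w k * exp (x \<bullet> v k)) *\<^sub>R c k) sums exp_moment v w c x"
  unfolding exp_moment_def
  by (rule summable_sums[OF summable_norm_cancel[OF exp_moment_summable_norm[OF assms]]])

lemma bounded_range_scaleR_inner:
  fixes v :: "nat \<Rightarrow> 'a::euclidean_space" and c :: "nat \<Rightarrow> 'b::real_normed_vector"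
  assumes "bounded (range v)" "bounded (range c)"
  shows "bounded (range (\<lambda>k. (v k \<bullet> h) *\<^sub>R c k))"
proof -
  obtain R C where R: "\<And>k. norm (v k) \<le> R" and C: "\<And>k. norm (c k) \<le> C"
    using assms by (auto simp: bounded_iff)
  have "norm ((v k \<bullet> h) *\<^sub>R c k) \<le> R * norm h * C" for k
  proof -
    have "\<bar>v k \<bullet> h\<bar> \<le> R * norm h"
      by (meson Cauchy_Schwarz_ineq2 R mult_right_mono norm_ge_zero order_trans)
    then show ?thesis
      using C[of k] by (simp add: mult_mono)
  qed
  then show ?thesis
    by (auto simp: bounded_iff)
qed

text \<open>Termwise differentiation on a ball about 0 containing \<open>x\<close>: there the
  derivatives of the terms are at most a constant times \<open>w k\<close>, so the tails of the
  summable \<open>w\<close> give uniform convergence.\<close>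

lemma has_derivative_exp_moment:
  assumes w: "\<And>k. 0 \<le> w k" "summable w" and v: "bounded (range v)" and c: "bounded (range c)"
  shows "(exp_moment v w c has_derivative (\<lambda>h. exp_moment v w (\<lambda>k. (v k \<bullet> h) *\<^sub>R c k) x)) (at x)"
proof -
  obtain R C where R: "\<And>k. norm (v k) \<le> R" and C: "\<And>k. norm (c k) \<le> C"
    using v c by (auto simp: bounded_iff)
  define r where "r = norm x + 1"
  let ?S = "ball (0 :: 'a) r"
  let ?f = "\<lambda>k y. (w k * exp (y \<bullet> v k)) *\<^sub>R c k"
  let ?f' = "\<lambda>k y h. (w k * exp (y \<bullet> v k)) *\<^sub>R ((v k \<bullet> h) *\<^sub>R c k)"
  let ?g' = "\<lambda>y h. exp_moment v w (\<lambda>k. (v k \<bullet> h) *\<^sub>R c k) y"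
  have x: "x \<in> ?S"
    by (simp add: r_def)
  have "\<exists>g. \<forall>y\<in>?S. (\<lambda>k. ?f k y) sums g y \<and> (g has_derivative ?g' y) (at y within ?S)"
  proof (rule has_derivative_series[OF convex_ball _ _ x exp_moment_sums[OF w v c]])
    fix k y
    show "(?f k has_derivative ?f' k y) (at y within ?S)"
      by (auto intro!: derivative_eq_intros simp: algebra_simps inner_commute)
  next
    fix e :: real assume "0 < e"
    \<comment> \<open>The summand 1 only makes \<open>M\<close> positive, so that
      \<open>e / M\<close> can bound a tail of \<open>w\<close>.\<close>
    define M where "M = exp (r * R) * (R * C) + 1"
    have RC: "0 \<le> R" "0 \<le> C"
      using order_trans[OF norm_ge_zero R[of 0]] order_trans[OF norm_ge_zero C[of 0]] by simp_all
    have "0 < M"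
      using RC by (simp add: M_def add_nonneg_pos)
    obtain N where N: "\<And>n. n \<ge> N \<Longrightarrow> norm (\<Sum>i. w (i + n)) < e / M"
      using suminf_exist_split[OF divide_pos_pos[OF \<open>0 < e\<close> \<open>0 < M\<close>] w(2)] by blast
    have "norm (sum (\<lambda>i. ?f' i y h) {..<n} - ?g' y h) \<le> e * norm h" if "n \<ge> N" "y \<in> ?S" for n y h
    proof -
      let ?t = "\<lambda>i. ?f' i y h"
      have bt: "norm (?t i) \<le> M * norm h * w i" for i
      proof -
        have "\<bar>v i \<bullet> h\<bar> \<le> R * norm h"
          by (meson Cauchy_Schwarz_ineq2 R mult_right_mono norm_ge_zero order_trans)
        then have "norm ((v i \<bullet> h) *\<^sub>R c i) \<le> R * norm h * C"
          using C[of i] RC by (simp add: mult_mono)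
        then have "norm (?t i) \<le> exp (r * R) * (R * norm h * C) * w i"
          using exp_moment_term_bound[of w i v R "\<lambda>i. (v i \<bullet> h) *\<^sub>R c i" _ y r] w(1) R that(2) by simp
        also have "\<dots> = (exp (r * R) * (R * C)) * (norm h * w i)"
          by simp
        also have "\<dots> \<le> M * (norm h * w i)"
          using w(1) by (intro mult_right_mono) (auto simp: M_def)
        finally show ?thesis
          by (simp add: mult.assoc)
      qed
      have sumn: "summable (\<lambda>i. norm (?t i))"
        by (rule exp_moment_summable_norm[OF w v bounded_range_scaleR_inner[OF v c]])
      have "sum ?t {..<n} - ?g' y h = - (\<Sum>i. ?t (i + n))"
        using suminf_minus_initial_segment[OF summable_norm_cancel[OF sumn], of n]
        by (simp add: exp_moment_def)
      then have "norm (sum ?t {..<n} - ?g' y h) = norm (\<Sum>i. ?t (i + n))"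
        by simp
      also have "\<dots> \<le> (\<Sum>i. norm (?t (i + n)))"
        using summable_ignore_initial_segment[OF sumn] by (rule summable_norm)
      also have "\<dots> \<le> (\<Sum>i. M * norm h * w (i + n))"
        using summable_ignore_initial_segment[OF sumn] summable_ignore_initial_segment[OF w(2)] bt
        by (intro suminf_le summable_mult) auto
      also have "\<dots> = M * norm h * (\<Sum>i. w (i + n))"
        using summable_ignore_initial_segment[OF w(2)] by (rule suminf_mult)
      also have "\<dots> \<le> M * norm h * (e / M)"
        using N[OF that(1)] \<open>0 < M\<close> by (intro mult_left_mono) auto
      also have "\<dots> = e * norm h"
        using \<open>0 < M\<close> by simp
      finally show ?thesis .
    qed
    then show "\<forall>\<^sub>F n in sequentially. \<forall>y\<in>?S. \<forall>h. norm (sum (\<lambda>i. ?f' i y h) {..<n} - ?g' y h) \<le> e * norm h"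
      unfolding eventually_sequentially by blast
  qed
  then obtain g where g: "\<And>y. y \<in> ?S \<Longrightarrow> (\<lambda>k. ?f k y) sums g y"
      "\<And>y. y \<in> ?S \<Longrightarrow> (g has_derivative ?g' y) (at y within ?S)"
    by blast
  have "(g has_derivative ?g' x) (at x)"
    using g(2)[OF x] at_within_open[OF x open_ball] by simp
  moreover have "g y = exp_moment v w c y" if "y \<in> ?S" for y
    using g(1)[OF that] exp_moment_sums[OF w v c] sums_unique2 by blast
  ultimately show ?thesis
    using has_derivative_transform_within_open[OF _ open_ball x] by blast
qed

lemma linear_exp_moment:
  assumes w: "\<And>k. 0 \<le> w k" "summable w" and v: "bounded (range v)" and c: "bounded (range c)"
    and f: "bounded_linear f"
  shows "f (exp_moment v w c x) = exp_moment v w (\<lambda>k. f (c k)) x"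
proof -
  have "(\<lambda>k. f ((w k * exp (x \<bullet> v k)) *\<^sub>R c k)) sums f (exp_moment v w c x)"
    by (rule bounded_linear.sums[OF f exp_moment_sums[OF w v c]])
  then show ?thesis
    unfolding exp_moment_def linear_simps(5)[OF f] by (rule sums_unique)
qed

lemma exp_moment_nonneg:
  assumes w: "\<And>k. 0 \<le> w k" "summable w" and v: "bounded (range v)" and c: "bounded (range c)"
    and pos: "\<And>k. 0 < w k \<Longrightarrow> 0 \<le> (c k :: real)"
  shows "0 \<le> exp_moment v w c x"
proof -
  have "0 \<le> (w k * exp (x \<bullet> v k)) *\<^sub>R c k" for k
    using w(1)[of k] pos[of k] by (cases "w k = 0") auto
  then show ?thesis
    by (rule sums_le[OF _ sums_zero exp_moment_sums[OF w v c]])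
qed

lemma exp_moment_pos:
  assumes w: "\<And>k. 0 \<le> w k" "summable w" and v: "bounded (range v)" and c: "bounded (range c)"
    and pos: "\<And>k. 0 < w k \<Longrightarrow> 0 \<le> (c k :: real)" and k: "0 < w k" "0 < c k"
  shows "0 < exp_moment v w c x"
proof -
  have "0 \<le> (w k * exp (x \<bullet> v k)) *\<^sub>R c k" for k
    using w(1)[of k] pos[of k] by (cases "w k = 0") auto
  moreover have "0 < (w k * exp (x \<bullet> v k)) *\<^sub>R c k"
    using k by simp
  ultimately show ?thesis
    unfolding exp_moment_def
    by (intro suminf_pos2[where i=k] sums_summable[OF exp_moment_sums[OF w v c]]) auto
qed

lemma exp_moment_ge_term:
  assumes w: "\<And>k. 0 \<le> w k" "summable w" and v: "bounded (range v)"
  shows "w k * exp (x \<bullet> v k) \<le> exp_moment v w (\<lambda>_. 1) x"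
proof -
  have "sum (\<lambda>k. (w k * exp (x \<bullet> v k)) *\<^sub>R (1::real)) {k} \<le> exp_moment v w (\<lambda>_. 1) x"
    unfolding exp_moment_def using w(1)
    by (intro sum_le_suminf sums_summable[OF exp_moment_sums[OF w v]]) auto
  then show ?thesis by simp
qed

lemma exp_moment_add:
  assumes w: "\<And>k. 0 \<le> w k" "summable w" and v: "bounded (range v)" and c: "bounded (range c)"
    and d: "bounded (range d)"
  shows "exp_moment v w (\<lambda>k. c k + d k) x = exp_moment v w c x + exp_moment v w d x"
proof -
  have "(\<lambda>k. (w k * exp (x \<bullet> v k)) *\<^sub>R (c k + d k)) sums (exp_moment v w c x + exp_moment v w d x)"
    using sums_add[OF exp_moment_sums[OF w v c] exp_moment_sums[OF w v d]]
    by (simp add: scaleR_add_right)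
  then show ?thesis
    unfolding exp_moment_def by (simp add: sums_iff)
qed

lemma exp_moment_weights:
  assumes w: "\<And>k. 0 \<le> w k" "summable w" and w': "\<And>k. 0 \<le> w' k" "summable w'"
    and v: "bounded (range v)" and c: "bounded (range c)" and "0 \<le> t"
  shows "exp_moment v (\<lambda>k. w k + t * w' k) c x = exp_moment v w c x + t *\<^sub>R exp_moment v w' c x"
proof -
  have "((w k + t * w' k) * exp (x \<bullet> v k)) *\<^sub>R c k =
      (w k * exp (x \<bullet> v k)) *\<^sub>R c k + t *\<^sub>R ((w' k * exp (x \<bullet> v k)) *\<^sub>R c k)" for k
    by (simp add: algebra_simps)
  then have "(\<lambda>k. ((w k + t * w' k) * exp (x \<bullet> v k)) *\<^sub>R c k) sums
      (exp_moment v w c x + t *\<^sub>R exp_moment v w' c x)"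
    using sums_add[OF exp_moment_sums[OF w v c] sums_scaleR_right[OF exp_moment_sums[OF w' v c], of t]]
    by simp
  then show ?thesis
    unfolding exp_moment_def by (simp add: sums_iff)
qed

subsection \<open>Gradient maps onto convex bodies\<close>

text \<open>Weights may be zero, and only the points of positive weight must lie in \<open>K\<close>
  and approximate it. Thus one sequence \<open>v\<close> can serve two nested bodies under different
  weights.\<close>

definition point_masses ::
    "'a::euclidean_space set \<Rightarrow> (nat \<Rightarrow> 'a) \<Rightarrow> (nat \<Rightarrow> real) \<Rightarrow> bool" where
  "point_masses K v w \<longleftrightarrow> (\<forall>k. 0 \<le> w k) \<and> summable w \<and> bounded (range v) \<and>
     (\<forall>k. 0 < w k \<longrightarrow> v k \<in> K) \<and> K \<subseteq> closure {v k |k. 0 < w k}"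

text \<open>The cumulant generating function of the masses; its first two derivatives are the mean
  and the covariance of the measure with weights proportional to
  \<open>w k * exp (x \<bullet> v k)\<close>.\<close>

definition log_moment :: "(nat \<Rightarrow> real^'n) \<Rightarrow> (nat \<Rightarrow> real) \<Rightarrow> real^'n \<Rightarrow> real" where
  "log_moment v w x = ln (exp_moment v w (\<lambda>_. 1) x)"

definition tilted_mean :: "(nat \<Rightarrow> real^'n) \<Rightarrow> (nat \<Rightarrow> real) \<Rightarrow> real^'n \<Rightarrow> real^'n" where
  "tilted_mean v w x = inverse (exp_moment v w (\<lambda>_. 1) x) *\<^sub>R exp_moment v w v x"

definition tilted_covariance :: "(nat \<Rightarrow> real^'n) \<Rightarrow> (nat \<Rightarrow> real) \<Rightarrow> real^'n \<Rightarrow> real^'n^'n" where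
  "tilted_covariance v w x =
     inverse (exp_moment v w (\<lambda>_. 1) x) *\<^sub>R exp_moment v w (\<lambda>k. outer (v k)) x - outer (tilted_mean v w x)"

text \<open>The growth condition says that the recession function of the potential \<open>p\<close> is
  the support function of \<open>K\<close>.\<close>
definition gradient_map ::
    "(real^'n) set \<Rightarrow> (real^'n \<Rightarrow> real) \<Rightarrow> (real^'n \<Rightarrow> real^'n) \<Rightarrow> (real^'n \<Rightarrow> real^'n^'n) \<Rightarrow> bool" where
  "gradient_map K p G H \<longleftrightarrow>
     (\<forall>x. (p has_derivative (\<lambda>h. G x \<bullet> h)) (at x)) \<and>
     (\<forall>x. (G has_derivative (\<lambda>h. H x *v h)) (at x)) \<and>
     continuous_on UNIV H \<and>
     (\<forall>x. H x \<in> psd_cone) \<and>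
     (\<forall>x h. h \<noteq> 0 \<longrightarrow> 0 < h \<bullet> (H x *v h)) \<and>
     range G \<subseteq> K \<and>
     (\<forall>\<delta>>0. \<exists>C. \<forall>x. \<forall>y\<in>K. x \<bullet> y - \<delta> * norm x - C \<le> p x)"

lemma outer_mult_vec: "outer a *v h = (a \<bullet> h) *\<^sub>R a"
proof -
  have "(\<Sum>c\<in>UNIV. a $ r * a $ c * h $ c) = (\<Sum>c\<in>UNIV. a $ c * h $ c) * a $ r" for r
    unfolding sum_distrib_right by (rule sum.cong) simp_all
  then show ?thesis
    by (simp add: vec_eq_iff outer_def matrix_vector_mult_def inner_vec_def)
qed

lemma bounded_linear_matrix_vector_mult_left: "bounded_linear (\<lambda>A :: real^'n^'m. A *v h)"
  by (rule linear_conv_bounded_linear[THEN iffD1], rule linearI)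
    (simp_all add: matrix_vector_mult_add_rdistrib scaleR_matrix_vector_assoc)

lemma continuous_on_outer [continuous_intros]:
  assumes "continuous_on S f"
  shows "continuous_on S (\<lambda>x. outer (f x))"
proof -
  have "continuous_on S (\<lambda>x. f x $ r * f x $ c)" for r c
    by (intro continuous_on_mult continuous_on_component assms)
  then show ?thesis
    unfolding outer_def by (intro continuous_on_vec_lambda)
qed

lemma bounded_range_outer:
  fixes v :: "nat \<Rightarrow> real^'n"
  assumes "bounded (range v)"
  shows "bounded (range (\<lambda>k. outer (v k)))"
proof -
  have "compact (closure (range v))"
    using assms by simp
  then have "compact (outer ` closure (range v))"
    using compact_continuous_image[OF continuous_on_outer[OF continuous_on_id]] by blast
  moreover have "range (\<lambda>k. outer (v k)) \<subseteq> outer ` closure (range v)"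
    using closure_subset[of "range v"] by blast
  ultimately show ?thesis
    by (rule bounded_subset[OF compact_imp_bounded])
qed

lemma bounded_range_add_const:
  fixes f :: "nat \<Rightarrow> 'a::real_normed_vector"
  assumes "bounded (range f)"
  shows "bounded (range (\<lambda>k. f k + c))"
  using bounded_translation[OF assms, of c] by (simp add: image_image add.commute)

text \<open>These are the cross terms in the expansion of \<open>outer (a - m)\<close>.\<close>

lemma linear_outer_left:
  fixes m :: "real^'n"
  shows "linear (\<lambda>a. (\<chi> r c. a $ r * m $ c) + (\<chi> r c. m $ r * a $ c) :: real^'n^'n)"
  by (rule linearI) (simp_all add: vec_eq_iff algebra_simps)

context
  fixes K :: "(real^'n) set" and v :: "nat \<Rightarrow> real^'n" and w :: "nat \<Rightarrow> real"
  assumes masses: "point_masses K v w" and body: "convex_body K"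
begin

private lemma weights: "0 \<le> w k" "summable w" and bounded_points: "bounded (range v)"
  and points_in: "0 < w k \<Longrightarrow> v k \<in> K" and points_dense: "K \<subseteq> closure {v k |k. 0 < w k}"
  using masses by (auto simp: point_masses_def)

private lemma bounded_const: "bounded (range (\<lambda>_::nat. c))"
  by simp

private lemmas derivative = has_derivative_exp_moment[OF weights bounded_points]

private lemma body_nonempty: "K \<noteq> {}" "compact K" "closed K" "convex K"
  using body interior_subset by (auto simp: convex_body_def intro: compact_imp_closed)

lemma exp_moment_one_pos: "0 < exp_moment v w (\<lambda>_. 1 :: real) x"
proof -
  have "{v k |k. 0 < w k} \<noteq> {}"
    using points_dense body_nonempty(1) by auto
  then obtain k where "0 < w k"
    by blast
  then show ?thesis
    by (intro exp_moment_pos[OF weights bounded_points]) auto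
qed

private lemma derivative_Z:
  "(exp_moment v w (\<lambda>_. 1 :: real) has_derivative (\<lambda>h. exp_moment v w v x \<bullet> h)) (at x)"
  using derivative[OF bounded_const, of "1 :: real" x]
    linear_exp_moment[OF weights bounded_points bounded_points bounded_linear_inner_left]
  by simp

lemma has_derivative_log_moment: "(log_moment v w has_derivative (\<lambda>h. tilted_mean v w x \<bullet> h)) (at x)"
  unfolding log_moment_def[abs_def] tilted_mean_def
  by (rule has_derivative_eq_rhs[OF has_derivative_ln[OF exp_moment_one_pos derivative_Z]])
    (simp add: fun_eq_iff divide_inverse mult.commute)

lemma has_derivative_tilted_mean:
  "(tilted_mean v w has_derivative (\<lambda>h. tilted_covariance v w x *v h)) (at x)"
proof -
  let ?Z = "exp_moment v w (\<lambda>_. 1 :: real)" and ?N = "exp_moment v w v"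
    and ?S = "exp_moment v w (\<lambda>k. outer (v k))"
  have S: "?S x *v h = exp_moment v w (\<lambda>k. (v k \<bullet> h) *\<^sub>R v k) x" for h
    unfolding linear_exp_moment[OF weights bounded_points bounded_range_outer[OF bounded_points]
          bounded_linear_matrix_vector_mult_left] outer_mult_vec ..
  have N: "(?N has_derivative (\<lambda>h. ?S x *v h)) (at x)"
    unfolding S by (rule derivative[OF bounded_points])
  have Z: "((\<lambda>x. inverse (?Z x)) has_derivative
      (\<lambda>h. - (inverse (?Z x) * (?N x \<bullet> h) * inverse (?Z x)))) (at x)"
    using exp_moment_one_pos[of x] by (intro Deriv.has_derivative_inverse derivative_Z) simp
  have "inverse (?Z x) *\<^sub>R (?S x *v h) +
        (- (inverse (?Z x) * (?N x \<bullet> h) * inverse (?Z x))) *\<^sub>R ?N x = tilted_covariance v w x *v h" for h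
    unfolding tilted_covariance_def matrix_vector_mult_diff_rdistrib outer_mult_vec
      scaleR_matrix_vector_assoc[symmetric] tilted_mean_def
    by (simp add: mult.assoc mult.commute)
  then show ?thesis
    using has_derivative_scaleR[OF Z N] unfolding tilted_mean_def[abs_def] by simp
qed

lemma continuous_on_tilted_covariance: "continuous_on UNIV (tilted_covariance v w)"
proof -
  have c: "continuous_on UNIV (exp_moment v w c)" if "bounded (range c)" for c :: "nat \<Rightarrow> 'b::banach"
    by (rule continuous_at_imp_continuous_on, rule ballI)
      (rule has_derivative_continuous[OF derivative[OF that]])
  have i: "continuous_on UNIV (\<lambda>x. inverse (exp_moment v w (\<lambda>_. 1 :: real) x))"
    using continuous_on_inverse[OF c[OF bounded_const]] exp_moment_one_pos by (metis less_irrefl)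
  show ?thesis
    unfolding tilted_covariance_def[abs_def] tilted_mean_def
    by (intro continuous_on_diff continuous_on_scaleR continuous_on_outer i c
        bounded_range_outer bounded_points)
qed

text \<open>A covariance is the second moment about the mean: the cross terms of
  \<open>outer (v k - m)\<close> contribute twice \<open>outer m\<close>, because \<open>m\<close>
  is the mean. Applying a functional \<open>f\<close> reduces positivity of the covariance to the
  values of \<open>f\<close> at rank one matrices.\<close>

private lemma linear_tilted_covariance:
  assumes f: "linear (f :: real^'n^'n \<Rightarrow> real)"
  shows "exp_moment v w (\<lambda>_. 1) x * f (tilted_covariance v w x) =
    exp_moment v w (\<lambda>k. f (outer (v k - tilted_mean v w x))) x"
proof -
  define m where "m = tilted_mean v w x"
  define L where "L = (\<lambda>a. f ((\<chi> r c. a $ r * m $ c) + (\<chi> r c. m $ r * a $ c)))"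
  let ?Z = "exp_moment v w (\<lambda>_. 1 :: real) x" and ?N = "exp_moment v w v x"
  have L: "linear L"
    unfolding L_def using linear_compose[OF linear_outer_left f] by (simp add: comp_def)
  have f': "bounded_linear f" and L': "bounded_linear L" "bounded_linear (\<lambda>a. - L a)"
    using f L linear_conv_bounded_linear bounded_linear_minus by blast+
  have bf: "bounded (range (\<lambda>k. f (outer (v k))))"
    using bounded_linear_image[OF bounded_range_outer[OF bounded_points] f'] by (simp add: image_image)
  have bL: "bounded (range (\<lambda>k. - L (v k)))"
    using bounded_linear_image[OF bounded_points L'(2)] by (simp add: image_image)
  have bLc: "bounded (range (\<lambda>k. - L (v k) + c))" for c
    by (rule bounded_range_add_const[OF bL])
  have "f (outer (a - m)) = f (outer a) + (- L a + f (outer m))" for a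
  proof -
    have "outer (a - m) = outer a - ((\<chi> r c. a $ r * m $ c) + (\<chi> r c. m $ r * a $ c)) + outer m"
      by (simp add: vec_eq_iff outer_def algebra_simps)
    then show ?thesis
      by (simp add: L_def linear_add[OF f] linear_diff[OF f])
  qed
  then have "exp_moment v w (\<lambda>k. f (outer (v k - m))) x =
      exp_moment v w (\<lambda>k. f (outer (v k)) + (- L (v k) + f (outer m))) x"
    by simp
  also have "\<dots> = exp_moment v w (\<lambda>k. f (outer (v k))) x +
      (exp_moment v w (\<lambda>k. - L (v k)) x + exp_moment v w (\<lambda>k. f (outer m)) x)"
    by (simp only: exp_moment_add[OF weights bounded_points bf bLc]
        exp_moment_add[OF weights bounded_points bL bounded_const])
  also have "exp_moment v w (\<lambda>k. f (outer (v k))) x = f (exp_moment v w (\<lambda>k. outer (v k)) x)"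
    by (simp add: linear_exp_moment[OF weights bounded_points bounded_range_outer[OF bounded_points] f'])
  also have "exp_moment v w (\<lambda>k. - L (v k)) x = - L ?N"
    by (simp add: linear_exp_moment[OF weights bounded_points bounded_points L'(2)])
  also have "exp_moment v w (\<lambda>k. f (outer m)) x = ?Z * f (outer m)"
    using linear_exp_moment[OF weights bounded_points bounded_const[of "1::real"]
        bounded_linear_mult_left[of "f (outer m)"], of x] by simp
  also have "L ?N = 2 * (?Z * f (outer m))"
  proof -
    have "?N = ?Z *\<^sub>R m"
      using exp_moment_one_pos[of x] by (simp add: m_def tilted_mean_def)
    moreover have "L m = 2 * f (outer m)"
      by (simp add: L_def linear_add[OF f] outer_def)
    ultimately show ?thesis
      by (simp add: linear_scale[OF L])
  qed
  also have "f (exp_moment v w (\<lambda>k. outer (v k)) x) = ?Z * (f (tilted_covariance v w x) + f (outer m))"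
    using exp_moment_one_pos[of x] by (simp add: tilted_covariance_def linear_diff[OF f] linear_scale[OF f] m_def)
  finally show ?thesis
    by (simp add: m_def algebra_simps)
qed

private lemma bounded_range_linear_outer:
  assumes "linear (f :: real^'n^'n \<Rightarrow> real)"
  shows "bounded (range (\<lambda>k. f (outer (v k - m))))"
proof -
  have "bounded (range (\<lambda>k. v k - m))"
    using bounded_range_add_const[OF bounded_points, of "- m"] by simp
  from bounded_linear_image[OF bounded_range_outer[OF this], of f] show ?thesis
    using assms by (simp add: image_image linear_conv_bounded_linear)
qed

lemma tilted_covariance_psd: "tilted_covariance v w x \<in> psd_cone"
  unfolding psd_cone_def
proof safe
  fix f :: "real^'n^'n \<Rightarrow> real"
  assume f: "linear f" "\<forall>a. 0 \<le> f (outer a)"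
  have "0 \<le> exp_moment v w (\<lambda>_. 1) x * f (tilted_covariance v w x)"
    unfolding linear_tilted_covariance[OF f(1)] using f
    by (intro exp_moment_nonneg[OF weights bounded_points] bounded_range_linear_outer) auto
  then show "0 \<le> f (tilted_covariance v w x)"
    using exp_moment_one_pos[of x] by (simp add: zero_le_mult_iff)
qed

text \<open>If the variance in direction \<open>h\<close> vanished, all masses and hence
  \<open>K\<close> would lie in one hyperplane, which the nonempty interior forbids.\<close>

lemma tilted_covariance_pos_def:
  assumes "h \<noteq> 0"
  shows "0 < h \<bullet> (tilted_covariance v w x *v h)"
proof -
  let ?f = "\<lambda>A :: real^'n^'n. h \<bullet> (A *v h)" and ?m = "tilted_mean v w x"
  have f: "linear ?f"
    using bounded_linear_compose[OF bounded_linear_inner_right bounded_linear_matrix_vector_mult_left]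
    by (simp add: linear_conv_bounded_linear)
  have fo: "?f (outer a) = (a \<bullet> h)\<^sup>2" for a
    by (simp add: outer_mult_vec inner_commute power2_eq_square)
  have "\<exists>k. 0 < w k \<and> (v k - ?m) \<bullet> h \<noteq> 0"
  proof (rule ccontr)
    assume "\<not> ?thesis"
    then have "{v k |k. 0 < w k} \<subseteq> {y. h \<bullet> y = h \<bullet> ?m}"
      by (auto simp: inner_diff_left inner_diff_right inner_commute)
    then have "K \<subseteq> {y. h \<bullet> y = h \<bullet> ?m}"
      using points_dense closure_minimal[OF _ closed_hyperplane] by blast
    then have "interior K \<subseteq> {}"
      using interior_mono interior_hyperplane[OF assms] by blast
    then show False
      using body by (simp add: convex_body_def)
  qed
  then obtain k where "0 < w k" "(v k - ?m) \<bullet> h \<noteq> 0"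
    by blast
  then have "0 < exp_moment v w (\<lambda>k. ?f (outer (v k - ?m))) x"
    by (intro exp_moment_pos[OF weights bounded_points bounded_range_linear_outer[OF f]])
      (auto simp: fo)
  then show ?thesis
    using linear_tilted_covariance[OF f, of x] zero_less_mult_pos exp_moment_one_pos[of x] by metis
qed

text \<open>A hyperplane separating the mean from \<open>K\<close> would have all masses strictly on
  one side, but an affine function averages to its value at the mean.\<close>

lemma tilted_mean_in: "tilted_mean v w x \<in> K"
proof (rule ccontr)
  assume "tilted_mean v w x \<notin> K"
  then obtain a b where ab: "a \<bullet> tilted_mean v w x < b" "\<And>y. y \<in> K \<Longrightarrow> b < a \<bullet> y"
    using separating_hyperplane_closed_point[OF body_nonempty(4,3)] by blast
  let ?Z = "exp_moment v w (\<lambda>_. 1 :: real) x"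
  have b1: "bounded (range (\<lambda>k. a \<bullet> v k))"
    using bounded_linear_image[OF bounded_points bounded_linear_inner_right] by (simp add: image_image)
  have "bounded (range (\<lambda>k. a \<bullet> v k + - b))"
    by (rule bounded_range_add_const[OF b1])
  then have "0 \<le> exp_moment v w (\<lambda>k. a \<bullet> v k + - b) x"
    using ab(2)[OF points_in] by (intro exp_moment_nonneg[OF weights bounded_points]) fastforce+
  also have "\<dots> = a \<bullet> exp_moment v w v x + - (?Z * b)"
    using linear_exp_moment[OF weights bounded_points bounded_const[of "1::real"]
        bounded_linear_mult_left[of "- b"], of x]
    unfolding exp_moment_add[OF weights bounded_points b1 bounded_const]
    by (simp add: linear_exp_moment[OF weights bounded_points bounded_points bounded_linear_inner_right])
  also have "a \<bullet> exp_moment v w v x = ?Z * (a \<bullet> tilted_mean v w x)"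
    using exp_moment_one_pos[of x] by (simp add: tilted_mean_def)
  finally have "?Z * b \<le> ?Z * (a \<bullet> tilted_mean v w x)"
    by simp
  then show False
    using ab(1) exp_moment_one_pos[of x] by simp
qed

text \<open>Finitely many balls of radius \<open>\<delta>\<close> around mass points cover
  \<open>K\<close>. A single term of the exponential sum, at a mass within \<open>\<delta>\<close>
  of \<open>y\<close>, gives the bound; \<open>C\<close> absorbs the logarithms of the finitely many
  weights involved.\<close>

lemma log_moment_growth:
  assumes "0 < \<delta>"
  shows "\<exists>C. \<forall>x. \<forall>y\<in>K. x \<bullet> y - \<delta> * norm x - C \<le> log_moment v w x"
proof -
  have "K \<subseteq> (\<Union>k\<in>{k. 0 < w k}. ball (v k) \<delta>)"
  proof
    fix y assume "y \<in> K"
    then have "y \<in> closure {v k |k. 0 < w k}"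
      using points_dense by blast
    then obtain k where "0 < w k" "dist (v k) y < \<delta>"
      using assms unfolding closure_approachable by blast
    then show "y \<in> (\<Union>k\<in>{k. 0 < w k}. ball (v k) \<delta>)"
      by auto
  qed
  then obtain I where I: "I \<subseteq> {k. 0 < w k}" "finite I" "K \<subseteq> (\<Union>k\<in>I. ball (v k) \<delta>)"
    using compactE_image[OF body_nonempty(2), of "{k. 0 < w k}" "\<lambda>k. ball (v k) \<delta>"] by blast
  define C where "C = (\<Sum>k\<in>I. \<bar>ln (w k)\<bar>)"
  have "x \<bullet> y - \<delta> * norm x - C \<le> log_moment v w x" if "y \<in> K" for x y
  proof -
    obtain k where k: "k \<in> I" "dist (v k) y < \<delta>"
      using subsetD[OF I(3) \<open>y \<in> K\<close>] unfolding UN_iff mem_ball by blast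
    have wk: "0 < w k"
      using k I by auto
    have "x \<bullet> (y - v k) \<le> norm x * norm (y - v k)"
      by (rule norm_cauchy_schwarz)
    also have "\<dots> \<le> norm x * \<delta>"
      using k(2) by (intro mult_left_mono) (auto simp: dist_norm norm_minus_commute)
    finally have "x \<bullet> y \<le> x \<bullet> v k + \<delta> * norm x"
      by (simp add: inner_diff_right mult.commute)
    moreover have "ln (w k * exp (x \<bullet> v k)) \<le> log_moment v w x"
      unfolding log_moment_def using wk exp_moment_ge_term[OF weights bounded_points] exp_moment_one_pos
      by (subst ln_le_cancel_iff) auto
    then have "ln (w k) + x \<bullet> v k \<le> log_moment v w x"
      using wk by (simp add: ln_mult)
    moreover have "\<bar>ln (w k)\<bar> \<le> C"
      unfolding C_def using k(1) I(2) member_le_sum[of k I "\<lambda>k. \<bar>ln (w k)\<bar>"] by auto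
    ultimately show ?thesis
      by linarith
  qed
  then show ?thesis
    by blast
qed

lemma gradient_map_tilted_mean:
  "gradient_map K (log_moment v w) (tilted_mean v w) (tilted_covariance v w)"
  unfolding gradient_map_def
  using has_derivative_log_moment has_derivative_tilted_mean continuous_on_tilted_covariance
    tilted_covariance_psd tilted_covariance_pos_def tilted_mean_in log_moment_growth
  by blast

end

lemma point_masses_exist:
  assumes "K \<noteq> {}" "bounded K"
  obtains v where "point_masses K v (\<lambda>k. (1/2)^k)"
proof -
  obtain T where T: "countable T" "T \<subseteq> K" "K \<subseteq> closure T"
    using separable by metis
  have "T \<noteq> {}"
    using T(3) assms(1) by auto
  define v where "v = from_nat_into T"
  have "range v = T"
    unfolding v_def using range_from_nat_into[OF \<open>T \<noteq> {}\<close> T(1)] .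
  then have "{v k |k. (0::real) < (1/2)^k} = T"
    by auto
  then have "point_masses K v (\<lambda>k. (1/2)^k)"
    unfolding point_masses_def using T \<open>range v = T\<close> bounded_subset[OF assms(2) T(2)]
    by (auto simp: summable_geometric)
  then show ?thesis
    by (rule that)
qed

text \<open>Along the segment from \<open>y\<close> to \<open>x\<close> the derivative of
  \<open>(x - y) \<bullet> G\<close> is the Hessian form at \<open>x - y\<close>, which is
  positive.\<close>

lemma gradient_map_increasing:
  fixes G :: "real^'n \<Rightarrow> real^'n"
  assumes "gradient_map K p G H" "x \<noteq> y"
  shows "0 < (x - y) \<bullet> (G x - G y)"
proof -
  define g where "g = (\<lambda>t. (x - y) \<bullet> G (y + t *\<^sub>R (x - y)))"
  have "g 0 < g 1"
  proof (rule DERIV_pos_imp_increasing[OF zero_less_one])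
    fix t :: real
    let ?d = "(x - y) \<bullet> (H (y + t *\<^sub>R (x - y)) *v (x - y))"
    have "(G has_derivative (\<lambda>h. H (y + t *\<^sub>R (x - y)) *v h)) (at (y + t *\<^sub>R (x - y)))"
      using assms(1) by (simp add: gradient_map_def)
    moreover have "((\<lambda>t. y + t *\<^sub>R (x - y)) has_derivative (\<lambda>s. s *\<^sub>R (x - y))) (at t)"
      by (auto intro!: derivative_eq_intros)
    ultimately have "((\<lambda>t. G (y + t *\<^sub>R (x - y))) has_derivative
        (\<lambda>s. H (y + t *\<^sub>R (x - y)) *v (s *\<^sub>R (x - y)))) (at t)"
      by (rule has_derivative_compose[rotated])
    then have "(g has_derivative (\<lambda>s. (x - y) \<bullet> (H (y + t *\<^sub>R (x - y)) *v (s *\<^sub>R (x - y))))) (at t)"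
      unfolding g_def by (rule has_derivative_inner_right)
    moreover have "(\<lambda>s. (x - y) \<bullet> (H (y + t *\<^sub>R (x - y)) *v (s *\<^sub>R (x - y)))) = (\<lambda>s. ?d * s)"
      by (simp add: matrix_vector_mult_scaleR fun_eq_iff)
    ultimately have "(g has_field_derivative ?d) (at t)"
      by (simp add: has_field_derivative_def)
    moreover have "0 < ?d"
      using assms by (simp add: gradient_map_def)
    ultimately show "\<exists>d. (g has_field_derivative d) (at t) \<and> 0 < d"
      by blast
  qed
  then show ?thesis
    by (simp add: g_def inner_diff_right)
qed

section \<open>Gradients of nonnegative combinations of potentials\<close>

abbreviation minkowski_combination :: "nat \<Rightarrow> (nat \<Rightarrow> real) \<Rightarrow> (nat \<Rightarrow> 'a::real_vector set) \<Rightarrow> 'a set" where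
  "minkowski_combination m l K \<equiv> \<Sum>j<m. (\<lambda>x. l j *\<^sub>R x) ` K j"

lemma mem_minkowski_combination:
  "y \<in> minkowski_combination m l K \<longleftrightarrow> (\<exists>k. (\<forall>j<m. k j \<in> K j) \<and> y = (\<Sum>j<m. l j *\<^sub>R k j))"
  (is "?L \<longleftrightarrow> ?R")
proof
  assume ?L
  then obtain s where s: "y = sum s {..<m}" "\<forall>j\<in>{..<m}. s j \<in> (\<lambda>x. l j *\<^sub>R x) ` K j"
    by (auto simp: set_sum_alt)
  from s(2) have "\<forall>j. \<exists>k. j < m \<longrightarrow> k \<in> K j \<and> s j = l j *\<^sub>R k"
    by blast
  then obtain k where "\<And>j. j < m \<Longrightarrow> k j \<in> K j \<and> s j = l j *\<^sub>R k j"
    by metis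
  with s(1) show ?R
    by (intro exI[of _ k]) auto
next
  assume ?R
  then show ?L
    by (auto simp: set_sum_alt)
qed

lemma compact_minkowski_combination:
  fixes K :: "nat \<Rightarrow> 'a::euclidean_space set"
  assumes "\<And>j. j < m \<Longrightarrow> compact (K j)"
  shows "compact (minkowski_combination m l K)"
  using assms
proof (induction m)
  case (Suc m)
  then have "compact {x + y | x y. x \<in> minkowski_combination m l K \<and> y \<in> (\<lambda>x. l m *\<^sub>R x) ` K m}"
    by (intro compact_sums compact_scaling) auto
  moreover have "{x + y | x y. x \<in> minkowski_combination m l K \<and> y \<in> (\<lambda>x. l m *\<^sub>R x) ` K m} =
      minkowski_combination (Suc m) l K"
    by (auto simp: set_plus_def)
  ultimately show ?case
    by simp
qed auto

lemma convex_minkowski_combination: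
  assumes "\<And>j. j < m \<Longrightarrow> convex (K j)"
  shows "convex (minkowski_combination m l K)"
  using assms by (intro convex_set_sum convex_scaling) auto

text \<open>The index \<open>i\<close> with \<open>0 < l i\<close> excludes the degenerate
  combination and makes the gradient \<open>T\<close> of the combined potential strictly
  monotone.\<close>

locale minkowski_gradient =
  fixes m :: nat and l :: "nat \<Rightarrow> real" and K :: "nat \<Rightarrow> (real^'n) set"
    and p :: "nat \<Rightarrow> real^'n \<Rightarrow> real" and G :: "nat \<Rightarrow> real^'n \<Rightarrow> real^'n"
    and H :: "nat \<Rightarrow> real^'n \<Rightarrow> real^'n^'n" and i :: nat
  assumes grad: "\<And>j. j < m \<Longrightarrow> gradient_map (K j) (p j) (G j) (H j)"
    and body: "\<And>j. j < m \<Longrightarrow> convex_body (K j)"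
    and l_nonneg: "\<And>j. j < m \<Longrightarrow> 0 \<le> l j" and i: "i < m" "0 < l i"
begin

abbreviation "S \<equiv> minkowski_combination m l K"
definition "T x = (\<Sum>j<m. l j *\<^sub>R G j x)"
definition "HT x = (\<Sum>j<m. l j *\<^sub>R H j x)"

lemma has_derivative_T: "(T has_derivative (\<lambda>h. HT x *v h)) (at x)"
proof -
  have "(T has_derivative (\<lambda>h. \<Sum>j<m. l j *\<^sub>R (H j x *v h))) (at x)"
    unfolding T_def[abs_def] using grad
    by (intro has_derivative_sum has_derivative_scaleR_right) (auto simp: gradient_map_def)
  moreover have "(\<Sum>j<m. l j *\<^sub>R (H j x *v h)) = HT x *v h" for h
    unfolding HT_def scaleR_matrix_vector_assoc
    using linear_sum[OF bounded_linear.linear[OF bounded_linear_matrix_vector_mult_left[of h]],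
        of "\<lambda>j. l j *\<^sub>R H j x" "{..<m}"] by simp
  ultimately show ?thesis
    by simp
qed

lemma inj_T: "inj T"
proof (rule injI, rule ccontr)
  fix x y assume xy: "T x = T y" "x \<noteq> y"
  have pos: "0 < (x - y) \<bullet> (G j x - G j y)" if "j < m" for j
    using gradient_map_increasing[OF grad[OF that] xy(2)] .
  have "(x - y) \<bullet> (T x - T y) = (\<Sum>j<m. l j * ((x - y) \<bullet> (G j x - G j y)))"
    by (simp add: T_def sum_subtractf[symmetric] scaleR_diff_right[symmetric] inner_sum_right
        del: inner_diff_right)
  also have "0 < \<dots>"
    using pos l_nonneg i
    by (intro sum_pos2[of _ i] mult_pos_pos mult_nonneg_nonneg) (auto simp: less_imp_le)
  finally show False
    using xy(1) by simp
qed

lemma T_in: "T x \<in> S"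
  unfolding mem_minkowski_combination T_def
  using grad by (intro exI[of _ "\<lambda>j. G j x"]) (auto simp: gradient_map_def)

text \<open>Each summand is given the error rate \<open>\<delta> / L\<close>, where \<open>L\<close>
  is the total weight, so that the weighted errors add up to \<open>\<delta>\<close>.\<close>

lemma potential_growth:
  assumes "0 < \<delta>"
  shows "\<exists>C. \<forall>x. \<forall>y\<in>S. x \<bullet> y - \<delta> * norm x - C \<le> (\<Sum>j<m. l j * p j x)"
proof -
  define L where "L = sum l {..<m}"
  have L: "0 < L"
    unfolding L_def using l_nonneg i by (intro sum_pos2[of _ i]) auto
  have "\<exists>C. \<forall>x. \<forall>y\<in>K j. x \<bullet> y - \<delta> / L * norm x - C \<le> p j x" if "j < m" for j
  proof -
    have "\<forall>\<delta>>0. \<exists>C. \<forall>x. \<forall>y\<in>K j. x \<bullet> y - \<delta> * norm x - C \<le> p j x"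
      using grad[OF that] unfolding gradient_map_def by (elim conjE)
    then show ?thesis
      using divide_pos_pos[OF assms L] by (simp only:)
  qed
  then have "\<forall>j. \<exists>C. j < m \<longrightarrow> (\<forall>x. \<forall>y\<in>K j. x \<bullet> y - \<delta> / L * norm x - C \<le> p j x)"
    by (intro allI) (rule ccontr, simp)
  from choice[OF this] obtain C
    where C: "\<And>j x y. j < m \<Longrightarrow> y \<in> K j \<Longrightarrow> x \<bullet> y - \<delta> / L * norm x - C j \<le> p j x"
    by blast
  have "x \<bullet> y - \<delta> * norm x - (\<Sum>j<m. l j * C j) \<le> (\<Sum>j<m. l j * p j x)" if y: "y \<in> S" for x y
  proof -
    obtain k where k: "\<And>j. j < m \<Longrightarrow> k j \<in> K j" "y = (\<Sum>j<m. l j *\<^sub>R k j)"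
      using y unfolding mem_minkowski_combination by blast
    have "L * (\<delta> / L * norm x) = \<delta> * norm x"
      using L by simp
    then have "(\<Sum>j<m. l j * (\<delta> / L * norm x)) = \<delta> * norm x"
      by (simp only: sum_distrib_right[symmetric] L_def)
    then have "x \<bullet> y - \<delta> * norm x - (\<Sum>j<m. l j * C j) =
        (\<Sum>j<m. l j * (x \<bullet> k j - \<delta> / L * norm x - C j))"
      by (simp add: k(2) inner_sum_right right_diff_distrib sum_subtractf)
    also have "\<dots> \<le> (\<Sum>j<m. l j * p j x)"
      using C k(1) l_nonneg by (intro sum_mono mult_left_mono) auto
    finally show ?thesis .
  qed
  then show ?thesis
    by blast
qed

text \<open>At a minimiser of the potential minus \<open>x \<bullet> y\<close> the gradient
  \<open>T\<close> takes the value \<open>y\<close>. The minimum exists because a ball of radius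
  \<open>e\<close> about \<open>y\<close> lies in \<open>S\<close>: growth with error rate
  \<open>e / 2\<close> still leaves slope \<open>e / 2\<close>.\<close>

lemma interior_subset_range_T: "interior S \<subseteq> range T"
proof
  fix y assume "y \<in> interior S"
  then obtain e where e: "0 < e" "cball y e \<subseteq> S"
    using mem_interior_cball by blast
  define f where "f = (\<lambda>x. (\<Sum>j<m. l j * p j x) - x \<bullet> y)"
  obtain C where C: "\<And>x y. y \<in> S \<Longrightarrow> x \<bullet> y - e / 2 * norm x - C \<le> (\<Sum>j<m. l j * p j x)"
    using potential_growth[of "e / 2"] e(1) by auto
  have growth: "e / 2 * norm x - C \<le> f x" for x
  proof -
    \<comment> \<open>The farthest point of the ball in direction \<open>x\<close> gains
      \<open>e * norm x\<close> in the inner product.\<close>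
    have "y + e *\<^sub>R sgn x \<in> cball y e"
      using e(1) by (simp add: dist_norm norm_sgn)
    then have "x \<bullet> (y + e *\<^sub>R sgn x) - e / 2 * norm x - C \<le> (\<Sum>j<m. l j * p j x)"
      using C e(2) by blast
    moreover have "x \<bullet> sgn x = norm x"
      by (cases "x = 0") (simp_all add: sgn_div_norm dot_square_norm power2_eq_square)
    ultimately show ?thesis
      by (simp add: f_def inner_add_right)
  qed
  have f': "(f has_derivative (\<lambda>h. (T x - y) \<bullet> h)) (at x)" for x
  proof -
    have "(f has_derivative (\<lambda>h. (\<Sum>j<m. l j * (G j x \<bullet> h)) - h \<bullet> y)) (at x)"
      unfolding f_def using grad
      by (intro has_derivative_diff has_derivative_sum has_derivative_mult_right
          has_derivative_inner_left has_derivative_ident) (auto simp: gradient_map_def)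
    then show ?thesis
      by (simp add: T_def inner_diff_right inner_sum_right inner_commute)
  qed
  \<comment> \<open>Outside the ball of radius \<open>r\<close> the growth bound alone gives at
    least \<open>f 0\<close>, so the minimum over the ball is global.\<close>
  define r where "r = (\<bar>f 0\<bar> + \<bar>C\<bar>) * 2 / e"
  have "0 \<le> r"
    using e(1) by (simp add: r_def)
  have "continuous_on (cball 0 r) f"
    using has_derivative_continuous[OF f'] by (intro continuous_at_imp_continuous_on) auto
  then obtain x where x: "x \<in> cball 0 r" "\<And>z. z \<in> cball 0 r \<Longrightarrow> f x \<le> f z"
    using continuous_attains_inf[OF compact_cball, of "0 :: real^'n" r f] \<open>0 \<le> r\<close> by auto
  have "f x \<le> f z" for z
  proof (cases "z \<in> cball 0 r")
    case False
    then have "e / 2 * r \<le> e / 2 * norm z"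
      using e(1) by (intro mult_left_mono) auto
    moreover have "e / 2 * r = \<bar>f 0\<bar> + \<bar>C\<bar>"
      using e(1) by (simp add: r_def)
    ultimately have "f 0 \<le> f z"
      using growth[of z] by linarith
    moreover have "f x \<le> f 0"
      using \<open>0 \<le> r\<close> by (intro x(2)) auto
    ultimately show ?thesis
      by linarith
  qed (rule x(2))
  then have "(\<lambda>h. (T x - y) \<bullet> h) = (\<lambda>h. 0)"
    by (intro has_derivative_local_min[OF f']) auto
  then have "(T x - y) \<bullet> (T x - y) = 0"
    by metis
  then show "y \<in> range T"
    by auto
qed

text \<open>The two sets differ only within the frontier of \<open>S\<close>, a null set by
  convexity.\<close>

lemma range_T_lmeasurable: "range T \<in> lmeasurable \<and> measure lebesgue (range T) = measure lebesgue S"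
proof -
  have S: "convex S" "bounded S"
    using convex_minkowski_combination[of m K l] compact_minkowski_combination[of m K l] body
    by (auto simp: convex_body_def compact_imp_bounded)
  then have "S \<in> lmeasurable"
    by (rule measurable_convex)
  moreover have "negligible (S - range T \<union> (range T - S))"
  proof (rule negligible_subset[OF negligible_convex_frontier[OF S(1)]])
    show "S - range T \<union> (range T - S) \<subseteq> frontier S"
      using interior_subset_range_T T_in closure_subset[of S] by (auto simp: frontier_def)
  qed
  ultimately show ?thesis
    using lmeasurable_negligible_symdiff[of S "range T"] measure_negligible_symdiff[of S "range T"]
    by blast
qed

end

section \<open>Volumes as integrals of mixed discriminants\<close>

definition mixed_integral :: "(real^'n \<Rightarrow> real^'n^'n) list \<Rightarrow> real" where
  "mixed_integral Hs = (\<integral>x. mixed_discriminant (map (\<lambda>H. H x) Hs) \<partial>lborel)"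

lemma continuous_on_det:
  fixes A :: "'a::topological_space \<Rightarrow> real^'n^'n"
  assumes "\<And>r. continuous_on S (\<lambda>x. A x $ r)"
  shows "continuous_on S (\<lambda>x. det (A x))"
  unfolding det_def
  by (intro continuous_on_sum continuous_on_mult continuous_on_const continuous_on_prod
      continuous_on_component assms)

lemma continuous_on_mixed_discriminant:
  fixes Hs :: "('a::topological_space \<Rightarrow> real^'n^'n) list"
  assumes len: "length Hs = CARD('n)" and cont: "\<And>H. H \<in> set Hs \<Longrightarrow> continuous_on S H"
  shows "continuous_on S (\<lambda>x. mixed_discriminant (map (\<lambda>H. H x) Hs))"
proof -
  have "continuous_on S (\<lambda>x. det (\<chi> r. (map (\<lambda>H. H x) Hs ! \<sigma> r) $ r))"
    if "\<sigma> \<in> slot_bijections" for \<sigma> :: "'n \<Rightarrow> nat"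
  proof (rule continuous_on_det)
    fix r
    have "\<sigma> r < length Hs"
      using that len by (auto simp: bij_betw_def)
    then have "continuous_on S (\<lambda>x. (Hs ! \<sigma> r) x $ r)"
      using cont by (intro continuous_on_component) auto
    then show "continuous_on S (\<lambda>x. (\<chi> r. (map (\<lambda>H. H x) Hs ! \<sigma> r) $ r) $ r)"
      using \<open>\<sigma> r < length Hs\<close> by simp
  qed
  then show ?thesis
    unfolding mixed_discriminant_def divide_inverse
    by (intro continuous_on_mult continuous_on_sum continuous_on_const) auto
qed

lemma gradient_map_hessian:
  assumes "gradient_map K p G H"
  shows "continuous_on UNIV H" "H x \<in> psd_cone"
proof -
  show "continuous_on UNIV H"
    using assms unfolding gradient_map_def by (elim conjE)
  have "\<forall>x. H x \<in> psd_cone"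
    using assms unfolding gradient_map_def by (elim conjE)
  then show "H x \<in> psd_cone" ..
qed

lemma gradient_map_mixed_discriminant:
  fixes Hs :: "(real^'n \<Rightarrow> real^'n^'n) list"
  assumes "length Hs = CARD('n)" "\<And>H. H \<in> set Hs \<Longrightarrow> \<exists>K p G. gradient_map K p G H"
  shows "(\<lambda>x. mixed_discriminant (map (\<lambda>H. H x) Hs)) \<in> borel_measurable borel"
    and "0 \<le> mixed_discriminant (map (\<lambda>H. H x) Hs)"
proof -
  have "continuous_on UNIV (\<lambda>x. mixed_discriminant (map (\<lambda>H. H x) Hs))"
    using assms gradient_map_hessian(1) by (intro continuous_on_mixed_discriminant) blast+
  then show "(\<lambda>x. mixed_discriminant (map (\<lambda>H. H x) Hs)) \<in> borel_measurable borel"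
    by (rule borel_measurable_continuous_onI)
  show "0 \<le> mixed_discriminant (map (\<lambda>H. H x) Hs)"
  proof (rule mixed_discriminant_nonneg)
    show "set (map (\<lambda>H. H x) Hs) \<subseteq> psd_cone"
      using assms(2) gradient_map_hessian(2) by (metis image_subsetI list.set_map)
  qed (simp add: assms(1))
qed

lemma map_gradient_maps:
  assumes grad: "\<And>j. j < m \<Longrightarrow> gradient_map (K j) (p j) (G j) (H j)"
    and "set js \<subseteq> {..<m}" "H' \<in> set (map H js)"
  shows "\<exists>K p G. gradient_map K p G H'"
proof -
  obtain j where "j < m" "H' = H j"
    using assms(2,3) by auto
  then show ?thesis
    using grad by blast
qed

lemma integrable_lborel_if_has_integral:
  fixes f :: "'a::euclidean_space \<Rightarrow> real"
  assumes "(f has_integral c) UNIV" "\<And>x. 0 \<le> f x" "f \<in> borel_measurable borel"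
  shows "integrable lborel f" "(\<integral>x. f x \<partial>lborel) = c"
proof -
  have "f absolutely_integrable_on UNIV"
    using assms by (intro nonnegative_absolutely_integrable_1) auto
  then have i: "integrable lebesgue f"
    by (simp add: set_integrable_def)
  then show int: "integrable lborel f"
    using assms(3) by (simp add: integrable_completion)
  have "(f has_integral (\<integral>x. f x \<partial>lborel)) UNIV"
    using int by (rule has_integral_integral_lborel)
  then show "(\<integral>x. f x \<partial>lborel) = c"
    using assms(1) has_integral_unique by blast
qed

lemma finite_index_lists: "finite {js. set js \<subseteq> {..<m::nat} \<and> length js = n}"
  using finite_lists_length_eq[of "{..<m}" n] by simp

text \<open>Change of variables along the injective map \<open>T\<close>. The Jacobian needs no
  absolute value, as its expansion into mixed discriminants has only nonnegative terms.\<close>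

lemma measure_minkowski_integral:
  fixes K :: "nat \<Rightarrow> (real^'n::{finite,wellorder}) set"
  assumes grad: "\<And>j. j < m \<Longrightarrow> gradient_map (K j) (p j) (G j) (H j)"
    and body: "\<And>j. j < m \<Longrightarrow> convex_body (K j)"
    and l: "\<And>j. j < m \<Longrightarrow> 0 \<le> l j" "i < m" "0 < l i"
  shows "integrable lborel (\<lambda>x. det (\<Sum>j<m. l j *\<^sub>R H j x))"
    and "(\<integral>x. det (\<Sum>j<m. l j *\<^sub>R H j x) \<partial>lborel) = measure lebesgue (minkowski_combination m l K)"
proof -
  interpret minkowski_gradient m l K p G H i
    using assms by unfold_locales
  have "(\<Sum>js | set js \<subseteq> {..<m} \<and> length js = CARD('n).
      prod_list (map l js) * mixed_discriminant (map (\<lambda>H. H x) (map H js))) \<ge> 0" for x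
  proof (intro sum_nonneg mult_nonneg_nonneg prod_list_nonneg)
    fix js assume js: "js \<in> {js. set js \<subseteq> {..<m} \<and> length js = CARD('n)}"
    show "0 \<le> a" if "a \<in> set (map l js)" for a
      using that js l(1) by auto
    show "0 \<le> mixed_discriminant (map (\<lambda>H. H x) (map H js))"
      using js map_gradient_maps[of m K p G H, OF grad] by (intro gradient_map_mixed_discriminant) auto
  qed
  then have nonneg: "0 \<le> det (HT x)" for x
    by (simp add: HT_def det_sum_eq_mixed_discriminants comp_def)
  have "continuous_on UNIV HT"
    unfolding HT_def[abs_def] using grad
    by (intro continuous_on_sum continuous_on_scaleR continuous_on_const) (auto simp: gradient_map_def)
  then have meas: "(\<lambda>x. det (HT x)) \<in> borel_measurable borel"
    by (intro borel_measurable_continuous_onI continuous_on_det continuous_on_component)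
  have "((\<lambda>x. \<bar>det (matrix (\<lambda>h. HT x *v h))\<bar>) has_integral measure lebesgue S) UNIV"
    using has_measure_differentiable_image[of UNIV T "\<lambda>x h. HT x *v h" "measure lebesgue S"]
      has_derivative_T inj_T range_T_lmeasurable by auto
  then have "((\<lambda>x. det (HT x)) has_integral measure lebesgue S) UNIV"
    using nonneg by simp
  from integrable_lborel_if_has_integral[OF this nonneg meas]
  show "integrable lborel (\<lambda>x. det (\<Sum>j<m. l j *\<^sub>R H j x))"
    and "(\<integral>x. det (\<Sum>j<m. l j *\<^sub>R H j x) \<partial>lborel) = measure lebesgue (minkowski_combination m l K)"
    by (simp_all add: HT_def)
qed

text \<open>With all weights equal to 1 the determinant is integrable, and the mixed discriminant is
  one of its nonnegative summands.\<close>

lemma integrable_mixed_discriminant: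
  fixes K :: "nat \<Rightarrow> (real^'n::{finite,wellorder}) set"
  assumes grad: "\<And>j. j < m \<Longrightarrow> gradient_map (K j) (p j) (G j) (H j)"
    and body: "\<And>j. j < m \<Longrightarrow> convex_body (K j)"
    and js: "set js \<subseteq> {..<m}" "length js = CARD('n)"
  shows "integrable lborel (\<lambda>x. mixed_discriminant (map (\<lambda>H. H x) (map H js)))"
proof -
  have "js \<noteq> []"
    using js(2) by auto
  then have "0 < m"
    using js(1) by (cases js) auto
  note H = map_gradient_maps[of m K p G H, OF grad]
  have nonneg: "0 \<le> mixed_discriminant (map (\<lambda>H. H x) (map H ks))"
    if "set ks \<subseteq> {..<m}" "length ks = CARD('n)" for x ks
    using gradient_map_mixed_discriminant(2)[of "map H ks"] H that by simp
  show ?thesis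
  proof (rule Bochner_Integration.integrable_bound)
    show "integrable lborel (\<lambda>x. det (\<Sum>j<m. 1 *\<^sub>R H j x))"
      using measure_minkowski_integral(1)[of m K p G H "\<lambda>_. 1" 0, OF grad body] \<open>0 < m\<close> by auto
    show "(\<lambda>x. mixed_discriminant (map (\<lambda>H. H x) (map H js))) \<in> borel_measurable lborel"
      using gradient_map_mixed_discriminant(1)[of "map H js"] H js by auto
    have le: "mixed_discriminant (map (\<lambda>H. H x) (map H js)) \<le> det (\<Sum>j<m. 1 *\<^sub>R H j x)" for x
    proof -
      have "prod_list (map (\<lambda>_. 1) js) * mixed_discriminant (map (\<lambda>H. H x) (map H js)) \<le>
        (\<Sum>js | set js \<subseteq> {..<m} \<and> length js = CARD('n).
          prod_list (map (\<lambda>_. 1) js) * mixed_discriminant (map (\<lambda>H. H x) (map H js)))"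
        using nonneg js
        by (intro member_le_sum finite_index_lists mult_nonneg_nonneg prod_list_nonneg)
          (auto simp del: map_map)
      then show ?thesis
        by (simp add: det_sum_eq_mixed_discriminants[of "\<lambda>_. 1" "\<lambda>j. H j x" m, simplified]
            comp_def map_replicate_const)
    qed
    have "\<bar>mixed_discriminant (map (\<lambda>H. H x) (map H js))\<bar> \<le> \<bar>det (\<Sum>j<m. 1 *\<^sub>R H j x)\<bar>" for x
      using le[of x] nonneg[OF js, of x] by linarith
    then show "AE x in lborel. norm (mixed_discriminant (map (\<lambda>H. H x) (map H js))) \<le>
        norm (det (\<Sum>j<m. 1 *\<^sub>R H j x))"
      by simp
  qed
qed

lemma measure_minkowski_combination:
  fixes K :: "nat \<Rightarrow> (real^'n::{finite,wellorder}) set"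
  assumes grad: "\<And>j. j < m \<Longrightarrow> gradient_map (K j) (p j) (G j) (H j)"
    and body: "\<And>j. j < m \<Longrightarrow> convex_body (K j)"
    and l: "\<And>j. j < m \<Longrightarrow> 0 \<le> l j"
  shows "measure lebesgue (minkowski_combination m l K) =
    (\<Sum>js | set js \<subseteq> {..<m} \<and> length js = CARD('n). prod_list (map l js) * mixed_integral (map H js))"
proof (cases "\<exists>i<m. 0 < l i")
  case True
  then obtain i where i: "i < m" "0 < l i"
    by blast
  have "measure lebesgue (minkowski_combination m l K) = (\<integral>x. det (\<Sum>j<m. l j *\<^sub>R H j x) \<partial>lborel)"
    using measure_minkowski_integral(2)[of m K p G H l i, OF grad body l i] by simp
  also have "\<dots> = (\<integral>x. (\<Sum>js | set js \<subseteq> {..<m} \<and> length js = CARD('n).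
      prod_list (map l js) * mixed_discriminant (map (\<lambda>H. H x) (map H js))) \<partial>lborel)"
    by (simp add: det_sum_eq_mixed_discriminants comp_def)
  also have "\<dots> = (\<Sum>js | set js \<subseteq> {..<m} \<and> length js = CARD('n).
      prod_list (map l js) * mixed_integral (map H js))"
    unfolding mixed_integral_def
    using integrable_mixed_discriminant[of m K p G H, OF grad body]
    by (subst Bochner_Integration.integral_sum) auto
  finally show ?thesis .
next
  case False
  \<comment> \<open>Without a positive weight there is no injective gradient. Here the combination
    lies in \<open>{0}\<close>, and every product of weights vanishes because index lists are
    nonempty.\<close>
  then have l0: "l j = 0" if "j < m" for j
    using l[OF that] that False by (metis order_le_less)
  have "y = 0" if "y \<in> minkowski_combination m l K" for y
    using that l0 unfolding mem_minkowski_combination by auto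
  then have "minkowski_combination m l K \<subseteq> {0}"
    by blast
  then have "measure lebesgue (minkowski_combination m l K) = 0"
    by (intro negligible_imp_measure0 negligible_subset[OF negligible_sing])
  moreover have "prod_list (map l js) = 0" if "set js \<subseteq> {..<m}" "length js = CARD('n)" for js
    using that l0 by (cases js) auto
  ultimately show ?thesis
    by simp
qed

subsection \<open>Reindexing by a well-ordered type\<close>

text \<open>The change of variables theorem of the library is restricted to well-ordered index types.\<close>
typedef 'a rank = "{..<CARD('a::finite)}"
  by (rule exI[of _ 0]) simp

instantiation rank :: (finite) "{finite, wellorder}"
begin

definition less_eq_rank :: "'a rank \<Rightarrow> 'a rank \<Rightarrow> bool" where
  "less_eq_rank x y \<longleftrightarrow> Rep_rank x \<le> Rep_rank y"

definition less_rank :: "'a rank \<Rightarrow> 'a rank \<Rightarrow> bool" where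
  "less_rank x y \<longleftrightarrow> Rep_rank x < Rep_rank y"

instance
proof
  have "(UNIV :: 'a rank set) = Abs_rank ` {..<CARD('a)}"
    using type_definition.Abs_image[OF type_definition_rank, where 'a1='a] by simp
  then show "finite (UNIV :: 'a rank set)"
    by (metis finite_imageI finite_lessThan)
  fix P :: "'a rank \<Rightarrow> bool" and a
  assume step: "\<And>x. (\<And>y. y < x \<Longrightarrow> P y) \<Longrightarrow> P x"
  show "P a"
    by (induction "Rep_rank a" arbitrary: a rule: less_induct) (use step in \<open>auto simp: less_rank_def\<close>)
qed (auto simp: less_eq_rank_def less_rank_def Rep_rank_inject)

end

lemma card_rank: "CARD('a rank) = CARD('a::finite)"
  using type_definition.card[OF type_definition_rank, where 'a1='a] by simp

lemma prod_Basis_vec: "(\<Prod>b\<in>(Basis :: (real^'n) set). f b) = (\<Prod>i\<in>UNIV. f (axis i 1))"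
proof -
  have B: "(Basis :: (real^'n) set) = range (\<lambda>i. axis i 1)"
    by (auto simp: Basis_vec_def)
  have "inj (\<lambda>i :: 'n. axis i (1 :: real))"
    by (simp add: inj_def axis_eq_axis)
  then show ?thesis
    unfolding B using prod.reindex[of "\<lambda>i :: 'n. axis i (1 :: real)" UNIV f] by (simp add: comp_def)
qed

text \<open>Relabelling coordinates matches open boxes with open boxes of the same edge lengths, and
  the values on open boxes determine Lebesgue measure.\<close>

lemma distr_lborel_reindex:
  fixes b :: "'m::finite \<Rightarrow> 'n::finite"
  assumes b: "bij b"
  shows "distr lborel borel (\<lambda>x :: real^'n. \<chi> j. x $ b j) = lborel"
proof (rule lborel_eqI[symmetric])
  let ?T = "\<lambda>x :: real^'n. \<chi> j. x $ b j"
  have meas: "?T \<in> borel_measurable borel"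
    by (intro borel_measurable_continuous_onI continuous_intros)
  fix l u :: "real^'m"
  assume lu: "\<And>b. b \<in> Basis \<Longrightarrow> l \<bullet> b \<le> u \<bullet> b"
  let ?l = "\<chi> i. l $ inv b i" and ?u = "\<chi> i. u $ inv b i"
  have b': "inv b (b j) = j" "b (inv b i) = i" for i j
    using b by (simp_all add: bij_is_inj bij_is_surj surj_f_inv_f)
  have lu': "l $ j \<le> u $ j" for j
    using lu[of "axis j 1"] by (simp add: inner_axis)
  have "?T -` box l u = box ?l ?u"
  proof (intro set_eqI iffI)
    fix x assume "x \<in> ?T -` box l u"
    then have "\<And>j. l $ j < x $ b j \<and> x $ b j < u $ j"
      by (simp add: mem_box_cart)
    from this[of "inv b _"] show "x \<in> box ?l ?u"
      by (simp add: mem_box_cart b')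
  next
    fix x assume "x \<in> box ?l ?u"
    then have "\<And>i. l $ inv b i < x $ i \<and> x $ i < u $ inv b i"
      by (simp add: mem_box_cart)
    from this[of "b _"] show "x \<in> ?T -` box l u"
      by (simp add: mem_box_cart b')
  qed
  then have "emeasure (distr lborel borel ?T) (box l u) = emeasure lborel (box ?l ?u)"
    using meas by (simp add: emeasure_distr)
  also have "\<dots> = (\<Prod>c\<in>Basis. (?u - ?l) \<bullet> c)"
    using lu'
    by (intro emeasure_lborel_box) (auto simp: Basis_vec_def inner_axis)
  also have "(\<Prod>c\<in>Basis. (?u - ?l) \<bullet> c) = (\<Prod>i\<in>UNIV. u $ inv b i - l $ inv b i)"
    by (simp add: prod_Basis_vec inner_axis)
  also have "\<dots> = (\<Prod>j\<in>UNIV. u $ j - l $ j)"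
    using prod.reindex_bij_betw[OF bij_imp_bij_inv[OF b], of "\<lambda>j. u $ j - l $ j"] by simp
  also have "\<dots> = (\<Prod>c\<in>Basis. (u - l) \<bullet> c)"
    by (simp add: prod_Basis_vec inner_axis)
  finally show "emeasure (distr lborel borel ?T) (box l u) = (\<Prod>c\<in>Basis. (u - l) \<bullet> c)" .
qed simp

lemma measure_reindex_image:
  fixes b :: "'m::finite \<Rightarrow> 'n::finite" and S :: "(real^'n) set"
  assumes b: "bij b" and S: "compact S"
  shows "measure lebesgue ((\<lambda>x. \<chi> j. x $ b j) ` S) = measure lebesgue S"
proof -
  let ?T = "\<lambda>x :: real^'n. \<chi> j. x $ b j"
  have cont: "continuous_on A ?T" for A
    by (intro continuous_intros)
  have meas: "?T \<in> borel_measurable borel"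
    by (intro borel_measurable_continuous_onI cont)
  have TS: "compact (?T ` S)"
    by (rule compact_continuous_image[OF cont S])
  have "inj ?T"
  proof (rule injI)
    fix x y assume "?T x = ?T y"
    then have "x $ b j = y $ b j" for j
      by (simp add: vec_eq_iff)
    from this[of "inv b _"] show "x = y"
      by (simp add: vec_eq_iff surj_f_inv_f[OF bij_is_surj[OF b]])
  qed
  then have "?T -` (?T ` S) = S"
    by (rule inj_vimage_image_eq)
  then have "measure (distr lborel borel ?T) (?T ` S) = measure lborel S"
    using meas TS by (subst measure_distr) (auto simp: borel_compact)
  then show ?thesis
    using S TS by (simp add: distr_lborel_reindex[OF b] borel_compact)
qed

section \<open>Mixed volume functionals under linear bijections\<close>

lemma convex_body_linear_image:
  fixes J :: "'a::euclidean_space \<Rightarrow> 'b::euclidean_space"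
  assumes J: "linear J" "bij J" and K: "convex_body K"
  shows "convex_body (J ` K)"
proof -
  have "interior (J ` K) = J ` interior K"
    by (rule interior_bijective_linear_image[OF J])
  moreover have "compact (J ` K)"
    using K J(1) compact_continuous_image[OF linear_continuous_on[of J K]]
    by (simp add: convex_body_def linear_conv_bounded_linear)
  ultimately show ?thesis
    using K J(1) by (simp add: convex_body_def convex_linear_image)
qed

lemma mixed_volume_functional_permute:
  fixes Ks :: "'a::euclidean_space set list"
  assumes "mixed_volume_functional V" "length Ks = DIM('a)" "\<And>K. K \<in> set Ks \<Longrightarrow> convex_body K"
    and "mset Ls = mset Ks"
  shows "V Ls = V Ks"
  by (rule assms(1)[unfolded mixed_volume_functional_def, THEN conjunct1, rule_format])
    (intro conjI ballI assms)

lemma mixed_volume_functional_measure: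
  fixes K :: "nat \<Rightarrow> 'a::euclidean_space set"
  assumes "mixed_volume_functional V" "\<And>j. j < m \<Longrightarrow> convex_body (K j)" "\<And>j. j < m \<Longrightarrow> 0 \<le> l j"
  shows "measure lebesgue (minkowski_combination m l K) =
    (\<Sum>js | set js \<subseteq> {..<m} \<and> length js = DIM('a). prod_list (map l js) * V (map K js))"
  by (rule assms(1)[unfolded mixed_volume_functional_def, THEN conjunct2, rule_format])
    (intro conjI allI impI assms)

text \<open>A linear map commutes with Minkowski combinations, so both defining properties pull back
  along a measure preserving linear bijection.\<close>

lemma mixed_volume_functional_image:
  fixes J :: "'a::euclidean_space \<Rightarrow> 'b::euclidean_space"
  assumes J: "linear J" "bij J" and dim: "DIM('a) = DIM('b)"
    and meas: "\<And>S. compact S \<Longrightarrow> measure lebesgue (J ` S) = measure lebesgue S"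
    and V: "mixed_volume_functional V"
  shows "mixed_volume_functional (\<lambda>Ks. V (map (image J) Ks))"
  unfolding mixed_volume_functional_def
proof (intro conjI allI impI; (elim conjE)?)
  note body = convex_body_linear_image[OF J]
  {
    fix Ks Ls :: "'a set list"
    assume "length Ks = DIM('a)" "\<forall>K\<in>set Ks. convex_body K" "mset Ls = mset Ks"
    then show "V (map (image J) Ls) = V (map (image J) Ks)"
      using body dim by (intro mixed_volume_functional_permute[OF V]) auto
  next
    fix m :: nat and K :: "nat \<Rightarrow> 'a set" and l :: "nat \<Rightarrow> real"
    assume K: "\<forall>j<m. convex_body (K j)" and l: "\<forall>j<m. 0 \<le> l j"
    have eq: "J ` (\<Sum>j<m. (\<lambda>x. l j *\<^sub>R x) ` K j) = (\<Sum>j<m. (\<lambda>x. l j *\<^sub>R x) ` (J ` K j))" for m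
    proof (induction m)
      case 0
      then show ?case
        by (simp add: linear_0[OF J(1)])
    next
      case (Suc m)
      have plus: "J ` (A + B) = J ` A + J ` B" for A B
      proof
        show "J ` (A + B) \<subseteq> J ` A + J ` B"
          by (auto simp: set_plus_def linear_add[OF J(1)]) blast
        show "J ` A + J ` B \<subseteq> J ` (A + B)"
        proof
          fix y assume "y \<in> J ` A + J ` B"
          then obtain a b where ab: "a \<in> A" "b \<in> B" "y = J a + J b"
            by (auto simp: set_plus_def)
          then have "y = J (a + b)"
            by (simp add: linear_add[OF J(1)])
          then show "y \<in> J ` (A + B)"
            using set_plus_intro[OF ab(1,2)] by blast
        qed
      qed
      have scale: "J ` (\<lambda>x. c *\<^sub>R x) ` A = (\<lambda>x. c *\<^sub>R x) ` J ` A" for c A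
        by (simp add: image_image linear_scale[OF J(1)])
      show ?case
        by (simp add: plus scale Suc)
    qed
    have "compact (\<Sum>j<m. (\<lambda>x. l j *\<^sub>R x) ` K j)"
      using K by (intro compact_minkowski_combination) (simp add: convex_body_def)
    from meas[OF this] have "measure lebesgue (\<Sum>j<m. (\<lambda>x. l j *\<^sub>R x) ` K j) =
        measure lebesgue (\<Sum>j<m. (\<lambda>x. l j *\<^sub>R x) ` (J ` K j))"
      by (simp only: eq)
    also have "\<dots> = (\<Sum>js | set js \<subseteq> {..<m} \<and> length js = DIM('b).
        prod_list (map l js) * V (map (\<lambda>j. J ` K j) js))"
      using K l body by (intro mixed_volume_functional_measure[OF V]) auto
    finally show "measure lebesgue (\<Sum>j<m. (\<lambda>x. l j *\<^sub>R x) ` K j) =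
        (\<Sum>js | set js \<subseteq> {..<m} \<and> length js = DIM('a).
          prod_list (map l js) * V (map (image J) (map K js)))"
      by (simp add: dim comp_def)
  }
qed

subsection \<open>Mixed volumes of two bodies\<close>

text \<open>Splitting by the head of the list amounts to Pascal's rule.\<close>

lemma sum_index_lists_two:
  fixes f :: "nat \<Rightarrow> real"
  shows "(\<Sum>js | set js \<subseteq> {..<2} \<and> length js = n. f (count_list js (0 :: nat))) = (\<Sum>k\<le>n. real (n choose k) * f k)"
proof (induction n arbitrary: f)
  case 0
  have "{js :: nat list. set js \<subseteq> {..<2} \<and> length js = 0} = {[]}"
    by auto
  then show ?case
    by simp
next
  case (Suc n)
  let ?L = "\<lambda>n. {js :: nat list. set js \<subseteq> {..<2} \<and> length js = n}"
  have L: "?L (Suc n) = (#) 0 ` ?L n \<union> (#) 1 ` ?L n"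
  proof (intro set_eqI iffI)
    fix js assume js: "js \<in> ?L (Suc n)"
    then obtain a as where "js = a # as"
      by (cases js) auto
    then show "js \<in> (#) 0 ` ?L n \<union> (#) 1 ` ?L n"
      using js by (cases a) auto
  qed auto
  have fin: "finite (?L n)"
    by (rule finite_index_lists)
  have "(\<Sum>js\<in>?L (Suc n). f (count_list js 0)) =
      (\<Sum>js\<in>(#) 0 ` ?L n. f (count_list js 0)) + (\<Sum>js\<in>(#) 1 ` ?L n. f (count_list js 0))"
    unfolding L using fin by (intro sum.union_disjoint) auto
  also have "\<dots> = (\<Sum>js\<in>?L n. f (Suc (count_list js 0))) + (\<Sum>js\<in>?L n. f (count_list js 0))"
    by (simp add: sum.reindex)
  also have "\<dots> = (\<Sum>k\<le>n. real (n choose k) * f (Suc k)) + (\<Sum>k\<le>n. real (n choose k) * f k)"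
    using Suc[of f] Suc[of "\<lambda>k. f (Suc k)"] by simp
  also have "(\<Sum>k\<le>n. real (n choose k) * f k) = (\<Sum>k\<le>Suc n. real (n choose k) * f k)"
    by simp
  also have "\<dots> = f 0 + (\<Sum>k\<le>n. real (n choose Suc k) * f (Suc k))"
    by (subst sum.atMost_Suc_shift) simp
  also have "(\<Sum>k\<le>n. real (n choose k) * f (Suc k)) + (f 0 + (\<Sum>k\<le>n. real (n choose Suc k) * f (Suc k))) =
      f 0 + (\<Sum>k\<le>n. real (Suc n choose Suc k) * f (Suc k))"
    by (simp add: sum.distrib distrib_right)
  also have "\<dots> = (\<Sum>k\<le>Suc n. real (Suc n choose k) * f k)"
    by (simp only: sum.atMost_Suc_shift) simp
  finally show ?case .
qed

lemma mset_index_list_two: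
  assumes "set js \<subseteq> {..<2 :: nat}"
  shows "mset js = mset (replicate (count_list js 0) 0 @ replicate (length js - count_list js 0) 1)"
  using assms
proof (induction js)
  case (Cons a js)
  have "count_list js 0 \<le> length js"
    by (rule count_le_length)
  moreover have "a = 0 \<or> a = 1"
    using Cons.prems by auto
  ultimately show ?case
    using Cons by (auto simp: Suc_diff_le)
qed simp

lemma sum_index_lists_two_symmetric:
  fixes g :: "nat list \<Rightarrow> real"
  assumes sym: "\<And>js ks. set js \<subseteq> {..<2} \<Longrightarrow> length js = n \<Longrightarrow> mset ks = mset js \<Longrightarrow> g ks = g js"
  shows "(\<Sum>js | set js \<subseteq> {..<2} \<and> length js = n. prod_list (map l js) * g js) =
    (\<Sum>k\<le>n. real (n choose k) * (l 0 ^ k * l 1 ^ (n - k) * g (replicate k 0 @ replicate (n - k) 1)))"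
proof -
  let ?f = "\<lambda>k. l 0 ^ k * l 1 ^ (n - k) * g (replicate k 0 @ replicate (n - k) 1)"
  have "prod_list (map l js) * g js = ?f (count_list js 0)"
    if "set js \<subseteq> {..<2}" "length js = n" for js
  proof -
    let ?ks = "replicate (count_list js 0) 0 @ replicate (n - count_list js 0) (1 :: nat)"
    have m: "mset ?ks = mset js"
      using mset_index_list_two[OF that(1)] that(2) by simp
    then have "mset (map l js) = mset (map l ?ks)"
      by (metis mset_map)
    then have "prod_list (map l js) = prod_list (map l ?ks)"
      by (metis prod_mset_prod_list)
    then show ?thesis
      using sym[OF that m] by simp
  qed
  then have "(\<Sum>js | set js \<subseteq> {..<2} \<and> length js = n. prod_list (map l js) * g js) =
      (\<Sum>js | set js \<subseteq> {..<2 :: nat} \<and> length js = n. ?f (count_list js 0))"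
    by (intro sum.cong) auto
  then show ?thesis
    by (simp only: sum_index_lists_two[of ?f n])
qed

lemma polynomial_coeffs_eq_on_nonneg:
  fixes a b :: "nat \<Rightarrow> real"
  assumes "\<And>s. 0 \<le> s \<Longrightarrow> (\<Sum>k\<le>n. a k * s ^ k) = (\<Sum>k\<le>n. b k * s ^ k)" "k \<le> n"
  shows "a k = b k"
proof (rule ccontr)
  assume "a k \<noteq> b k"
  then have "finite {s. (\<Sum>k\<le>n. (a k - b k) * s ^ k) = 0}"
    using assms(2) polyfun_finite_roots[of "\<lambda>k. a k - b k" n] by auto
  moreover have "{0..} \<subseteq> {s. (\<Sum>k\<le>n. (a k - b k) * s ^ k) = 0}"
    using assms(1) by (auto simp: left_diff_distrib sum_subtractf)
  ultimately show False
    using finite_subset infinite_Ici by blast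
qed

text \<open>With the second weight fixed at 1 a polynomial in the single variable \<open>s\<close>
  remains, and it still carries all mixed volumes of the two bodies.\<close>

lemma mixed_volume_functional_two_bodies:
  fixes K :: "nat \<Rightarrow> 'a::euclidean_space set"
  assumes V: "mixed_volume_functional V" and body: "convex_body (K 0)" "convex_body (K 1)" and "0 \<le> (s :: real)"
  shows "measure lebesgue (minkowski_combination 2 (\<lambda>j. if j = 0 then s else 1) K) =
    (\<Sum>k\<le>DIM('a). (real (DIM('a) choose k) * V (replicate k (K 0) @ replicate (DIM('a) - k) (K 1))) * s ^ k)"
proof -
  let ?l = "\<lambda>j :: nat. if j = 0 then s else 1"
  have body': "convex_body (K j)" if "j < 2" for j
    using less_2_cases[OF that] body by (elim disjE) simp_all
  have "V (map K ks) = V (map K js)"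
    if "set js \<subseteq> {..<2}" "length js = DIM('a)" "mset ks = mset js" for js ks :: "nat list"
  proof (rule mixed_volume_functional_permute[OF V])
    fix L assume "L \<in> set (map K js)"
    then show "convex_body L"
      using that(1) body' by fastforce
  qed (use that in simp_all)
  note two = sum_index_lists_two_symmetric[of "DIM('a)" "\<lambda>js. V (map K js)" ?l, OF this]
  have "measure lebesgue (minkowski_combination 2 ?l K) =
      (\<Sum>js | set js \<subseteq> {..<2} \<and> length js = DIM('a). prod_list (map ?l js) * V (map K js))"
    using body' \<open>0 \<le> s\<close> by (intro mixed_volume_functional_measure[OF V]) simp_all
  also note two
  also have "(\<Sum>k\<le>DIM('a). real (DIM('a) choose k) * (?l 0 ^ k * ?l 1 ^ (DIM('a) - k) *
        V (map K (replicate k 0 @ replicate (DIM('a) - k) 1)))) =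
      (\<Sum>k\<le>DIM('a). (real (DIM('a) choose k) * V (replicate k (K 0) @ replicate (DIM('a) - k) (K 1))) * s ^ k)"
    by (intro sum.cong refl) simp
  finally show ?thesis .
qed

lemma mixed_integral_permute:
  fixes Hs :: "(real^'n \<Rightarrow> real^'n^'n) list"
  assumes "length Hs = CARD('n)" "mset Hs' = mset Hs"
  shows "mixed_integral Hs' = mixed_integral Hs"
proof -
  have "mixed_discriminant (map (\<lambda>H. H x) Hs') = mixed_discriminant (map (\<lambda>H. H x) Hs)" for x
    using assms by (intro mixed_discriminant_permute) simp_all
  then show ?thesis
    by (simp add: mixed_integral_def)
qed

text \<open>Both sides are coefficients of the same polynomial in \<open>s\<close>. Hence the value
  depends neither on \<open>V\<close> nor on the gradient maps chosen for the two bodies.\<close>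

lemma mixed_volume_functional_eq_integral:
  fixes K :: "nat \<Rightarrow> (real^'n::{finite,wellorder}) set"
  assumes V: "mixed_volume_functional V"
    and grad: "\<And>j. j < 2 \<Longrightarrow> gradient_map (K j) (p j) (G j) (H j)"
    and body: "\<And>j. j < 2 \<Longrightarrow> convex_body (K j)" and k: "k \<le> CARD('n)"
  shows "V (replicate k (K 0) @ replicate (CARD('n) - k) (K 1)) =
    mixed_integral (replicate k (H 0) @ replicate (CARD('n) - k) (H 1))"
proof -
  let ?n = "CARD('n)"
  have "(\<Sum>k\<le>?n. (real (?n choose k) * V (replicate k (K 0) @ replicate (?n - k) (K 1))) * s ^ k) =
      (\<Sum>k\<le>?n. (real (?n choose k) * mixed_integral (replicate k (H 0) @ replicate (?n - k) (H 1))) * s ^ k)"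
    if "0 \<le> s" for s
  proof -
    let ?l = "\<lambda>j :: nat. if j = 0 then s else 1"
    have sym: "mixed_integral (map H ks) = mixed_integral (map H js)"
      if "set js \<subseteq> {..<2}" "length js = ?n" "mset ks = mset js" for js ks :: "nat list"
      using that by (intro mixed_integral_permute) simp_all
    have "(\<Sum>k\<le>?n. (real (?n choose k) * V (replicate k (K 0) @ replicate (?n - k) (K 1))) * s ^ k) =
        measure lebesgue (minkowski_combination 2 ?l K)"
      using mixed_volume_functional_two_bodies[OF V, of K s] body that by simp
    also have "\<dots> = (\<Sum>js | set js \<subseteq> {..<2} \<and> length js = ?n.
        prod_list (map ?l js) * mixed_integral (map H js))"
      using that by (intro measure_minkowski_combination[of 2 K p G H ?l, OF grad body]) simp_all
    also note sum_index_lists_two_symmetric[of ?n "\<lambda>js. mixed_integral (map H js)" ?l, OF sym]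
    also have "(\<Sum>k\<le>?n. real (?n choose k) * (?l 0 ^ k * ?l 1 ^ (?n - k) *
          mixed_integral (map H (replicate k 0 @ replicate (?n - k) 1)))) =
        (\<Sum>k\<le>?n. (real (?n choose k) * mixed_integral (replicate k (H 0) @ replicate (?n - k) (H 1))) * s ^ k)"
      by (intro sum.cong refl) simp
    finally show ?thesis .
  qed
  from polynomial_coeffs_eq_on_nonneg[OF this k] show ?thesis
    using k by simp
qed

subsection \<open>Existence and monotonicity of mixed volumes\<close>

lemma gradient_map_exists:
  fixes K :: "(real^'n) set"
  assumes "convex_body K"
  shows "\<exists>p G H. gradient_map K p G H"
proof -
  have "K \<noteq> {}" "bounded K"
    using assms interior_subset by (auto simp: convex_body_def compact_imp_bounded)
  then obtain v where "point_masses K v (\<lambda>k. (1/2)^k)"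
    using point_masses_exist by metis
  from gradient_map_tilted_mean[OF this assms] show ?thesis
    by blast
qed

text \<open>Fixing one gradient map for every body turns the integral into a function of the
  bodies.\<close>

lemma mixed_volume_functional_mixed_integral:
  fixes H :: "(real^'n::{finite,wellorder}) set \<Rightarrow> real^'n::_ \<Rightarrow> real^'n::_^'n::_"
  assumes grad: "\<And>K. convex_body K \<Longrightarrow> gradient_map K (p K) (G K) (H K)"
  shows "mixed_volume_functional (\<lambda>Ks. mixed_integral (map H Ks))"
  unfolding mixed_volume_functional_def
proof (intro conjI allI impI; (elim conjE)?)
  fix Ks Ls :: "(real^'n::_) set list"
  assume "length Ks = DIM(real^'n::_)" "mset Ls = mset Ks"
  then show "mixed_integral (map H Ls) = mixed_integral (map H Ks)"
    by (intro mixed_integral_permute) simp_all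
next
  fix m :: nat and K :: "nat \<Rightarrow> (real^'n::_) set" and l :: "nat \<Rightarrow> real"
  assume K: "\<forall>j<m. convex_body (K j)" and l: "\<forall>j<m. 0 \<le> l j"
  have "measure lebesgue (minkowski_combination m l K) =
    (\<Sum>js | set js \<subseteq> {..<m} \<and> length js = CARD('n).
       prod_list (map l js) * mixed_integral (map (\<lambda>j. H (K j)) js))"
    using K l by (intro measure_minkowski_combination[of m K "\<lambda>j. p (K j)" "\<lambda>j. G (K j)"] grad) simp_all
  then show "measure lebesgue (minkowski_combination m l K) =
    (\<Sum>js | set js \<subseteq> {..<m} \<and> length js = DIM(real^'n::_).
       prod_list (map l js) * mixed_integral (map H (map K js)))"
    by (simp add: comp_def)
qed

lemma mixed_volume_functional_exists_wellorder:
  "\<exists>V :: (real^'n::{finite,wellorder}) set list \<Rightarrow> real. mixed_volume_functional V"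
proof -
  have "\<forall>K :: (real^'n::_) set. \<exists>d. convex_body K \<longrightarrow> gradient_map K (fst d) (fst (snd d)) (snd (snd d))"
    using gradient_map_exists by auto
  then obtain d where "\<And>K :: (real^'n::_) set. convex_body K \<Longrightarrow>
      gradient_map K (fst (d K)) (fst (snd (d K))) (snd (snd (d K)))"
    by metis
  from mixed_volume_functional_mixed_integral[OF this] show ?thesis
    by blast
qed

text \<open>Here \<open>w\<close> carries \<open>K\<close> and every \<open>w + t w'\<close> with \<open>t > 0\<close> carries the larger body \<open>L\<close>;
  letting \<open>t\<close> tend to 0 is what compares the mixed volumes of \<open>K\<close> and \<open>L\<close>.\<close>
lemma nested_point_masses:
  fixes K L :: "'a::euclidean_space set"
  assumes "K \<noteq> {}" "K \<subseteq> L" "bounded L"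
  obtains v w w' where "point_masses K v w" "\<And>k. 0 \<le> w' k" "summable w'"
    "\<And>t. 0 < t \<Longrightarrow> point_masses L v (\<lambda>k. w k + t * w' k)"
proof -
  have "bounded K" "L \<noteq> {}"
    using assms bounded_subset by auto
  then obtain vK vL where vK: "point_masses K vK (\<lambda>k. (1/2)^k)" and vL: "point_masses L vL (\<lambda>k. (1/2)^k)"
    using point_masses_exist assms(1,3) by metis
  have K: "range vK \<subseteq> K" "K \<subseteq> closure (range vK)" and L: "range vL \<subseteq> L" "L \<subseteq> closure (range vL)"
    using vK vL by (auto simp: point_masses_def full_SetCompr_eq)
  \<comment> \<open>The even indices carry the sequence of \<open>K\<close> and the odd ones that of
    \<open>L\<close>; \<open>w\<close> lives on the former, \<open>w'\<close> on the latter.\<close>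
  define v where "v k = (if even k then vK (k div 2) else vL (k div 2))" for k :: nat
  define w where "w k = (if even k then (1/2)^k else 0 :: real)" for k :: nat
  define w' where "w' k = (if even k then 0 else (1/2)^k :: real)" for k :: nat
  have sum: "summable w" "summable w'"
    by (rule summable_comparison_test'[OF summable_geometric[of "1/2 :: real"]];
        simp add: w_def w'_def)+
  have inK: "vK k \<in> K" and inL: "vK k \<in> L" "vL k \<in> L" for k
    using K(1) L(1) assms(2) by blast+
  then have "range v \<subseteq> L"
    by (auto simp: v_def)
  then have bv: "bounded (range v)"
    using assms(3) bounded_subset by metis
  have vK_v: "vK k = v (2 * k)" and vL_v: "vL k = v (Suc (2 * k))" for k
    by (simp_all add: v_def)
  have "range vK \<subseteq> {v k |k. 0 < w k}"
  proof safe
    fix k show "\<exists>j. vK k = v j \<and> 0 < w j"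
      by (rule exI[of _ "2 * k"]) (simp add: vK_v w_def)
  qed
  then have dK: "K \<subseteq> closure {v k |k. 0 < w k}"
    using K(2) closure_mono by blast
  have pK: "point_masses K v w"
    unfolding point_masses_def using sum bv dK inK
    by (auto simp: w_def v_def split: if_splits)
  have pL: "point_masses L v (\<lambda>k. w k + t * w' k)" if t: "0 < t" for t
  proof -
    have pos: "0 < w k + t * w' k" for k
      using t by (simp add: w_def w'_def)
    have "range vL \<subseteq> {v k |k. 0 < w k + t * w' k}"
      using pos vL_v by auto
    then have "L \<subseteq> closure {v k |k. 0 < w k + t * w' k}"
      using L(2) closure_mono by blast
    moreover have "summable (\<lambda>k. w k + t * w' k)"
      by (intro summable_add summable_mult sum)
    ultimately show ?thesis
      unfolding point_masses_def using bv less_imp_le[OF pos] \<open>range v \<subseteq> L\<close> by auto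
  qed
  show ?thesis
    using that[OF pK _ sum(2) pL] by (simp add: w'_def)
qed

text \<open>All moments are affine in \<open>t\<close>, so only the normalising factor has to be
  kept away from zero.\<close>

lemma continuous_tilted_covariance_weights:
  fixes v :: "nat \<Rightarrow> real^'n"
  assumes w: "\<And>k. 0 \<le> w k" "summable w" and w': "\<And>k. 0 \<le> w' k" "summable w'"
    and v: "bounded (range v)"
    and Z: "\<And>t. 0 \<le> t \<Longrightarrow> exp_moment v (\<lambda>k. w k + t * w' k) (\<lambda>_. 1 :: real) x \<noteq> 0"
  shows "continuous_on {0..} (\<lambda>t. tilted_covariance v (\<lambda>k. w k + t * w' k) x)"
proof -
  have c: "continuous_on {0..} (\<lambda>t. exp_moment v (\<lambda>k. w k + t * w' k) c x)"
    if "bounded (range c)" for c :: "nat \<Rightarrow> 'b::banach"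
  proof -
    have "continuous_on {0..} (\<lambda>t. exp_moment v w c x + t *\<^sub>R exp_moment v w' c x)"
      by (intro continuous_on_add continuous_on_scaleR continuous_on_const continuous_on_id)
    then show ?thesis
      using exp_moment_weights[OF w w' v that] by (subst continuous_on_cong[OF refl]) auto
  qed
  have i: "continuous_on {0..} (\<lambda>t. inverse (exp_moment v (\<lambda>k. w k + t * w' k) (\<lambda>_. 1 :: real) x))"
    using Z by (intro continuous_on_inverse c) auto
  show ?thesis
    unfolding tilted_covariance_def tilted_mean_def
    by (intro continuous_on_diff continuous_on_scaleR continuous_on_outer i c bounded_range_outer v)
qed

text \<open>Along \<open>t = 1 / (k + 1)\<close> the integrands converge pointwise to the one at 0
  while all integrals equal \<open>c\<close>. Mass may escape to infinity, hence an
  inequality.\<close>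

lemma mixed_integral_fatou:
  fixes Hs :: "(real \<Rightarrow> real^'n \<Rightarrow> real^'n^'n) list"
  assumes len: "length Hs = CARD('n)"
    and grad: "\<And>H t. H \<in> set Hs \<Longrightarrow> 0 \<le> t \<Longrightarrow> \<exists>K p G. gradient_map K p G (H t)"
    and cont: "\<And>H x. H \<in> set Hs \<Longrightarrow> continuous_on {0..} (\<lambda>t. H t x)"
    and int: "\<And>t. 0 < t \<Longrightarrow> integrable lborel (\<lambda>x. mixed_discriminant (map (\<lambda>H. H t x) Hs))"
    and int0: "integrable lborel (\<lambda>x. mixed_discriminant (map (\<lambda>H. H 0 x) Hs))"
    and const: "\<And>t. 0 < t \<Longrightarrow> mixed_integral (map (\<lambda>H. H t) Hs) = c"
  shows "mixed_integral (map (\<lambda>H. H 0) Hs) \<le> c"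
proof -
  define D where "D t x = mixed_discriminant (map (\<lambda>H. H t x) Hs)" for t x
  define \<tau> where "\<tau> k = inverse (real (Suc k))" for k
  have \<tau>: "0 < \<tau> k" "0 \<le> \<tau> k" for k
    by (simp_all add: \<tau>_def)
  have MI: "mixed_integral (map (\<lambda>H. H t) Hs) = (\<integral>x. D t x \<partial>lborel)" for t
    by (simp add: mixed_integral_def D_def comp_def)
  have grad': "\<exists>K p G. gradient_map K p G H'" if t: "0 \<le> t" and H': "H' \<in> set (map (\<lambda>H. H t) Hs)" for t H'
  proof -
    obtain H where "H \<in> set Hs" "H' = H t"
      using H' by auto
    then show ?thesis
      using grad t by blast
  qed
  have nonneg: "0 \<le> D t x" if "0 \<le> t" for t x
    using gradient_map_mixed_discriminant(2)[of "map (\<lambda>H. H t) Hs" x, OF _ grad'[OF that]] len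
    by (simp add: D_def comp_def)
  have meas: "D t \<in> borel_measurable borel" if "0 \<le> t" for t
    using gradient_map_mixed_discriminant(1)[of "map (\<lambda>H. H t) Hs", OF _ grad'[OF that]] len
    by (simp add: D_def[abs_def] comp_def)
  have Dint: "integrable lborel (D t)" if "0 \<le> t" for t
    using int[of t] int0 that by (cases "t = 0") (simp_all add: D_def[abs_def])
  have nn: "(\<integral>\<^sup>+ x. ennreal (D t x) \<partial>lborel) = ennreal c" if "0 < t" for t
    using Dint nonneg const[OF that] that unfolding MI by (subst nn_integral_eq_integral) auto
  have lim: "(\<lambda>k. D (\<tau> k) x) \<longlonglongrightarrow> D 0 x" for x
  proof (rule continuous_on_tendsto_compose[of "{0..}" "\<lambda>t. D t x"])
    have "continuous_on {0..} (\<lambda>t. mixed_discriminant (map (\<lambda>H. H t) (map (\<lambda>H t. H t x) Hs)))"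
      using len cont by (intro continuous_on_mixed_discriminant) auto
    then show "continuous_on {0..} (\<lambda>t. D t x)"
      by (simp add: D_def comp_def)
    show "\<tau> \<longlonglongrightarrow> 0"
      unfolding \<tau>_def by (rule LIMSEQ_inverse_real_of_nat)
  qed (use \<tau> in auto)
  have liminf: "liminf (\<lambda>k. ennreal (D (\<tau> k) x)) = ennreal (D 0 x)" for x
    by (intro lim_imp_Liminf tendsto_ennrealI lim) simp
  have "ennreal (mixed_integral (map (\<lambda>H. H 0) Hs)) = (\<integral>\<^sup>+ x. ennreal (D 0 x) \<partial>lborel)"
    using Dint nonneg unfolding MI by (subst nn_integral_eq_integral) auto
  also have "\<dots> = (\<integral>\<^sup>+ x. liminf (\<lambda>k. ennreal (D (\<tau> k) x)) \<partial>lborel)"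
    by (simp only: liminf)
  also have "\<dots> \<le> liminf (\<lambda>k. \<integral>\<^sup>+ x. ennreal (D (\<tau> k) x) \<partial>lborel)"
    using meas[OF \<tau>(2)] by (intro nn_integral_liminf) simp
  also have "\<dots> = ennreal c"
    using nn[OF \<tau>(1)] by (simp add: Liminf_const)
  finally have "ennreal (mixed_integral (map (\<lambda>H. H 0) Hs)) \<le> ennreal c" .
  moreover have "0 \<le> c"
    using const[of 1] nonneg[of 1] unfolding MI by (metis Bochner_Integration.integral_nonneg zero_le_one zero_less_one)
  ultimately show ?thesis
    by (simp add: ennreal_le_iff)
qed

lemma nested_gradient_maps:
  fixes K L :: "(real^'n) set"
  assumes K: "convex_body K" and L: "convex_body L" and "K \<subseteq> L"
  obtains p G H where "gradient_map K (p 0) (G 0) (H (0 :: real))"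
    "\<And>t. 0 < t \<Longrightarrow> gradient_map L (p t) (G t) (H t)" "\<And>x. continuous_on {0..} (\<lambda>t. H t x)"
proof -
  have "K \<noteq> {}" "bounded L"
    using K L interior_subset by (auto simp: convex_body_def compact_imp_bounded)
  from nested_point_masses[OF this(1) \<open>K \<subseteq> L\<close> this(2)]
  obtain v w w' where m0: "point_masses K v w" and w': "\<And>k. 0 \<le> w' k" "summable w'"
    and m: "\<And>t. 0 < t \<Longrightarrow> point_masses L v (\<lambda>k. w k + t * w' k)"
    by metis
  have w: "\<And>k. 0 \<le> w k" "summable w" and v: "bounded (range v)"
    using m0 by (simp_all add: point_masses_def)
  have w0: "(\<lambda>k. w k + 0 * w' k) = w"
    by simp
  have Z: "exp_moment v (\<lambda>k. w k + t * w' k) (\<lambda>_. 1 :: real) x \<noteq> 0" if "0 \<le> t" for t x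
  proof (cases "t = 0")
    case True
    then show ?thesis
      using exp_moment_one_pos[OF m0 K, of x] by simp
  next
    case False
    then show ?thesis
      using exp_moment_one_pos[OF m L, of t x] that by simp
  qed
  show ?thesis
  proof (rule that[of "\<lambda>t. log_moment v (\<lambda>k. w k + t * w' k)" "\<lambda>t. tilted_mean v (\<lambda>k. w k + t * w' k)"
        "\<lambda>t. tilted_covariance v (\<lambda>k. w k + t * w' k)"])
    show "gradient_map K (log_moment v (\<lambda>k. w k + 0 * w' k)) (tilted_mean v (\<lambda>k. w k + 0 * w' k))
        (tilted_covariance v (\<lambda>k. w k + 0 * w' k))"
      unfolding w0 by (rule gradient_map_tilted_mean[OF m0 K])
  qed (use gradient_map_tilted_mean[OF m L] continuous_tilted_covariance_weights[OF w w' v Z] in auto)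
qed

text \<open>Both slots are deformed with the same parameter: at \<open>t = 0\<close> the integral is
  the mixed volume of \<open>K\<close> and \<open>Q\<close>, at every \<open>t > 0\<close> it is
  that of \<open>L\<close> and \<open>R\<close>.\<close>

lemma mixed_volume_functional_mono_wellorder:
  fixes K L Q R :: "(real^'n::{finite,wellorder}) set"
  assumes V: "mixed_volume_functional V"
    and body: "convex_body K" "convex_body L" "convex_body Q" "convex_body R"
    and sub: "K \<subseteq> L" "Q \<subseteq> R" and k: "k \<le> CARD('n)"
  shows "V (replicate k K @ replicate (CARD('n) - k) Q) \<le> V (replicate k L @ replicate (CARD('n) - k) R)"
proof -
  let ?n = "CARD('n)"
  obtain p G H where H: "gradient_map K (p 0) (G 0) (H (0 :: real))"
    "\<And>t. 0 < t \<Longrightarrow> gradient_map L (p t) (G t) (H t)" "\<And>x. continuous_on {0..} (\<lambda>t. H t x)"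
    using nested_gradient_maps[OF body(1,2) sub(1)] by metis
  obtain p' G' H' where H': "gradient_map Q (p' 0) (G' 0) (H' (0 :: real))"
    "\<And>t. 0 < t \<Longrightarrow> gradient_map R (p' t) (G' t) (H' t)" "\<And>x. continuous_on {0..} (\<lambda>t. H' t x)"
    using nested_gradient_maps[OF body(3,4) sub(2)] by metis
  define Hs where "Hs = replicate k H @ replicate (?n - k) H'"
  have fam: "integrable lborel (\<lambda>x. mixed_discriminant (map (\<lambda>H. H t x) Hs)) \<and>
      mixed_integral (map (\<lambda>H. H t) Hs) = V (replicate k A @ replicate (?n - k) B)"
    if A: "gradient_map A (p t) (G t) (H t)" "convex_body A"
      and B: "gradient_map B (p' t) (G' t) (H' t)" "convex_body B" for A B t
  proof -
    let ?K = "\<lambda>j :: nat. if j = 0 then A else B" and ?H = "\<lambda>j :: nat. if j = 0 then H t else H' t"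
    let ?p = "\<lambda>j :: nat. if j = 0 then p t else p' t" and ?G = "\<lambda>j :: nat. if j = 0 then G t else G' t"
    let ?js = "replicate k 0 @ replicate (?n - k) (1 :: nat)"
    have grad: "gradient_map (?K j) (?p j) (?G j) (?H j)" for j
      using A B by simp
    have body: "convex_body (?K j)" for j
      using A B by simp
    have "integrable lborel (\<lambda>x. mixed_discriminant (map (\<lambda>H. H x) (map ?H ?js)))"
      using k by (intro integrable_mixed_discriminant[of 2 ?K ?p ?G ?H, OF grad body]) auto
    moreover have "map (\<lambda>H. H x) (map ?H ?js) = map (\<lambda>H. H t x) Hs" for x
      by (simp add: Hs_def)
    ultimately have int: "integrable lborel (\<lambda>x. mixed_discriminant (map (\<lambda>H. H t x) Hs))"
      by (simp only:)
    have "V (replicate k (?K 0) @ replicate (?n - k) (?K 1)) =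
        mixed_integral (replicate k (?H 0) @ replicate (?n - k) (?H 1))"
      using mixed_volume_functional_eq_integral[OF V, of ?K ?p ?G ?H, OF grad body k] .
    then show ?thesis
      using int by (simp add: Hs_def)
  qed
  have "mixed_integral (map (\<lambda>H. H 0) Hs) \<le> V (replicate k L @ replicate (?n - k) R)"
  proof (rule mixed_integral_fatou)
    show "length Hs = CARD('n)"
      using k by (simp add: Hs_def)
    fix F assume "F \<in> set Hs"
    then have F: "F = H \<or> F = H'"
      by (auto simp: Hs_def)
    then show "continuous_on {0..} (\<lambda>t. F t x)" for x
      using H(3) H'(3) by blast
    show "\<exists>K p G. gradient_map K p G (F t)" if "0 \<le> t" for t
    proof (cases "t = 0")
      case True
      then show ?thesis
        using F H(1) H'(1) by blast
    next
      case False
      then have "0 < t"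
        using that by simp
      then show ?thesis
        using F H(2) H'(2) by blast
    qed
  next
    show "integrable lborel (\<lambda>x. mixed_discriminant (map (\<lambda>H. H 0 x) Hs))"
      using fam[OF H(1) body(1) H'(1) body(3)] by blast
    fix t :: real assume t: "0 < t"
    show "integrable lborel (\<lambda>x. mixed_discriminant (map (\<lambda>H. H t x) Hs))"
      "mixed_integral (map (\<lambda>H. H t) Hs) = V (replicate k L @ replicate (?n - k) R)"
      using fam[OF H(2)[OF t] body(2) H'(2)[OF t] body(4)] by blast+
  qed
  then show ?thesis
    using fam[OF H(1) body(1) H'(1) body(3)] by simp
qed

section \<open>Transport to arbitrary finite index types\<close>

lemma linear_reindex:
  fixes b :: "'m::finite \<Rightarrow> 'n::finite"
  shows "linear (\<lambda>x :: real^'n. \<chi> j. x $ b j)"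
  by (rule linearI) (simp_all add: vec_eq_iff)

lemma reindex_inverse:
  fixes b :: "'m::finite \<Rightarrow> 'n::finite"
  assumes "bij b"
  shows "(\<lambda>x :: 'a^'m. \<chi> i. x $ inv b i) \<circ> (\<lambda>x :: 'a^'n. \<chi> j. x $ b j) = id"
    and "(\<lambda>x :: 'a^'n. \<chi> j. x $ b j) \<circ> (\<lambda>x :: 'a^'m. \<chi> i. x $ inv b i) = id"
  using assms by (auto simp: fun_eq_iff vec_eq_iff bij_is_surj surj_f_inv_f bij_is_inj)

lemma bij_reindex:
  fixes b :: "'m::finite \<Rightarrow> 'n::finite"
  assumes "bij b"
  shows "bij (\<lambda>x :: 'a^'n. \<chi> j. x $ b j)"
  using reindex_inverse[OF assms] by (rule o_bij)

lemma rank_bijection: "\<exists>b :: 'n::finite rank \<Rightarrow> 'n. bij b"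
  using finite_same_card_bij[of "UNIV :: 'n rank set" "UNIV :: 'n set"] by (simp add: card_rank)

lemma mixed_volume_functional_reindex:
  fixes V :: "(real^'m) set list \<Rightarrow> real" and b :: "'m \<Rightarrow> 'n::finite"
  assumes "mixed_volume_functional V" "bij b"
  shows "mixed_volume_functional (\<lambda>Ks. V (map (image (\<lambda>x. \<chi> j. x $ b j)) Ks))"
  using assms bij_betw_same_card[OF assms(2)]
  by (intro mixed_volume_functional_image linear_reindex bij_reindex measure_reindex_image) simp_all

lemma mixed_volume_functional_mixed_volume:
  "mixed_volume_functional (mixed_volume :: (real^'n) set list \<Rightarrow> real)"
proof -
  obtain W :: "(real^'n rank) set list \<Rightarrow> real" where "mixed_volume_functional W"
    using mixed_volume_functional_exists_wellorder by blast
  moreover obtain b :: "'n rank \<Rightarrow> 'n" where "bij b"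
    using rank_bijection by blast
  ultimately have "\<exists>V :: (real^'n) set list \<Rightarrow> real. mixed_volume_functional V"
    using mixed_volume_functional_reindex by blast
  then show ?thesis
    unfolding mixed_volume_def by (rule someI_ex)
qed

text \<open>The bodies are moved by \<open>J\<close> and the functional is pulled back along the
  inverse \<open>J'\<close>, so its values on the moved bodies are the original ones.\<close>

lemma mixed_volume_functional_mono:
  fixes K L Q R :: "(real^'n) set"
  assumes V: "mixed_volume_functional V"
    and body: "convex_body K" "convex_body L" "convex_body Q" "convex_body R"
    and sub: "K \<subseteq> L" "Q \<subseteq> R" and k: "k \<le> CARD('n)"
  shows "V (replicate k K @ replicate (CARD('n) - k) Q) \<le> V (replicate k L @ replicate (CARD('n) - k) R)"
proof -
  obtain b :: "'n rank \<Rightarrow> 'n" where b: "bij b"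
    using rank_bijection by blast
  define J where "J = (\<lambda>x :: real^'n. \<chi> j. x $ b j)"
  define J' where "J' = (\<lambda>x :: real^'n rank. \<chi> i. x $ inv b i)"
  have J: "linear J" "bij J"
    unfolding J_def using b by (auto intro: linear_reindex bij_reindex)
  have JJ: "J' ` J ` A = A" for A
    using reindex_inverse(1)[OF b, where 'a=real] by (simp add: J_def J'_def image_comp)
  have bodyJ: "convex_body (J ` A)" if "convex_body A" for A
    by (rule convex_body_linear_image[OF J that])
  have "mixed_volume_functional (\<lambda>Ks. V (map (image J') Ks))"
    unfolding J'_def by (rule mixed_volume_functional_reindex[OF V bij_imp_bij_inv[OF b]])
  from mixed_volume_functional_mono_wellorder[OF this bodyJ[OF body(1)] bodyJ[OF body(2)]
      bodyJ[OF body(3)] bodyJ[OF body(4)] image_mono[OF sub(1)] image_mono[OF sub(2)], of k]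
  show ?thesis
    using k by (simp add: JJ card_rank)
qed

subsection \<open>Mixed volumes of a long box and a cube\<close>

lemma minkowski_combination_boxes:
  fixes lo hi :: "real^'n"
  assumes "\<And>j. lo $ j \<le> hi $ j" "0 < r" "0 \<le> s"
  shows "minkowski_combination 2 (\<lambda>j. if j = 0 then s else 1)
      (\<lambda>j. if j = 0 then cbox lo hi else cbox (\<chi> i. - r) (\<chi> i. r)) =
    cbox (\<chi> i. s * lo $ i - r) (\<chi> i. s * hi $ i + r)"
    (is "?L = ?R")
proof (intro set_eqI iffI)
  fix y assume "y \<in> ?L"
  then obtain k :: "nat \<Rightarrow> real^'n" where k: "\<And>j. j < 2 \<Longrightarrow> k j \<in> (if j = 0 then cbox lo hi else cbox (\<chi> i. - r) (\<chi> i. r))"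
    and y: "y = (\<Sum>j<2. (if j = 0 then s else 1) *\<^sub>R k j)"
    unfolding mem_minkowski_combination by blast
  have c: "lo $ i \<le> k 0 $ i" "k 0 $ i \<le> hi $ i" and q: "- r \<le> k 1 $ i" "k 1 $ i \<le> r" for i
    using k[of 0] k[of 1] by (simp_all add: mem_box_cart)
  have "y $ i = s * k 0 $ i + k 1 $ i" for i
    by (simp add: y numeral_2_eq_2)
  then show "y \<in> ?R"
    using mult_left_mono[OF c(1) assms(3)] mult_left_mono[OF c(2) assms(3)] q
    by (simp add: mem_box_cart) (smt (verit))
next
  fix y assume y: "y \<in> ?R"
  \<comment> \<open>The relative position of \<open>y $ i\<close> in the summed interval; the same
    fraction locates the summands in the box and in the cube.\<close>
  define \<theta> where "\<theta> i = (y $ i - (s * lo $ i - r)) / (s * (hi $ i - lo $ i) + 2 * r)" for i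
  have pos: "0 < s * (hi $ i - lo $ i) + 2 * r" for i
    using assms by (intro add_nonneg_pos mult_nonneg_nonneg) auto
  have yi: "s * lo $ i - r \<le> y $ i" "y $ i \<le> s * hi $ i + r" for i
    using y by (simp_all add: mem_box_cart)
  have \<theta>: "0 \<le> \<theta> i" "\<theta> i \<le> 1" for i
    using pos[of i] yi[of i] by (simp_all add: \<theta>_def divide_simps algebra_simps)
  have \<theta>_mult: "\<theta> i * (s * (hi $ i - lo $ i) + 2 * r) = y $ i - (s * lo $ i - r)" for i
    using pos[of i] by (simp add: \<theta>_def)
  define k where "k j = (if j = 0 then (\<chi> i. lo $ i + \<theta> i * (hi $ i - lo $ i)) else (\<chi> i. - r + 2 * r * \<theta> i))"
    for j :: nat
  have "\<theta> i * (hi $ i - lo $ i) \<le> 1 * (hi $ i - lo $ i)" "0 \<le> \<theta> i * (hi $ i - lo $ i)" for i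
    using \<theta>[of i] assms(1)[of i] by (intro mult_right_mono mult_nonneg_nonneg; simp)+
  then have "k 0 \<in> cbox lo hi"
    by (simp add: k_def mem_box_cart) (smt (verit))
  moreover have "2 * r * \<theta> i \<le> 2 * r * 1" "0 \<le> 2 * r * \<theta> i" for i
    using \<theta>[of i] assms(2) by (intro mult_left_mono mult_nonneg_nonneg; simp)+
  then have "k 1 \<in> cbox (\<chi> i. - r) (\<chi> i. r)"
    by (simp add: k_def mem_box_cart)
  ultimately have k: "\<forall>j<2. k j \<in> (if j = 0 then cbox lo hi else cbox (\<chi> i. - r) (\<chi> i. r))"
    by (auto simp: less_2_cases_iff)
  have "y $ i = (\<Sum>j<2. (if j = 0 then s else 1) *\<^sub>R k j) $ i" for i
    using \<theta>_mult[of i] by (simp add: k_def numeral_2_eq_2 algebra_simps)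
  then have "y = (\<Sum>j<2. (if j = 0 then s else 1) *\<^sub>R k j)"
    by (simp add: vec_eq_iff)
  with k show "y \<in> ?L"
    unfolding mem_minkowski_combination by blast
qed

lemma convex_body_cbox_cart:
  fixes lo hi :: "real^'n"
  assumes "\<And>j. lo $ j < hi $ j"
  shows "convex_body (cbox lo hi)"
proof -
  have "(\<chi> j. (lo $ j + hi $ j) / 2) \<in> box lo hi"
    using assms by (auto simp: mem_box_cart field_simps)
  then show ?thesis
    unfolding convex_body_def interior_cbox using compact_cbox convex_box(1) by blast
qed

text \<open>For \<open>s\<close> times a box plus a cube of edge \<open>c\<close>, where the box has
  one edge \<open>d\<close> and \<open>m\<close> edges \<open>c\<close>, the left side is the
  volume.\<close>

lemma binomial_linear_expansion:
  fixes d c s :: real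
  shows "(s * d + c) * (c * (s + 1)) ^ m =
    (\<Sum>k\<le>Suc m. (c ^ m * (d * (if k = 0 then 0 else real (m choose (k - 1))) + c * real (m choose k))) * s ^ k)"
proof -
  have bin: "(s + 1) ^ m = (\<Sum>k\<le>m. real (m choose k) * s ^ k)"
    using binomial_ring[of s 1 m] by simp
  have 1: "(\<Sum>k\<le>Suc m. (if k = 0 then 0 else real (m choose (k - 1))) * s ^ k) = s * (s + 1) ^ m"
    by (simp add: sum.atMost_Suc_shift bin sum_distrib_left mult.left_commute del: sum.atMost_Suc)
  have 2: "(\<Sum>k\<le>Suc m. real (m choose k) * s ^ k) = (s + 1) ^ m"
    by (simp add: bin)
  have "(\<Sum>k\<le>Suc m. (c ^ m * (d * (if k = 0 then 0 else real (m choose (k - 1))) + c * real (m choose k))) * s ^ k) =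
      c ^ m * (d * (\<Sum>k\<le>Suc m. (if k = 0 then 0 else real (m choose (k - 1))) * s ^ k) +
        c * (\<Sum>k\<le>Suc m. real (m choose k) * s ^ k))"
    unfolding sum_distrib_left sum.distrib[symmetric]
    by (intro sum.cong refl) (simp add: algebra_simps)
  also have "\<dots> = (s * d + c) * (c * (s + 1)) ^ m"
    unfolding 1 2 power_mult_distrib by (simp add: algebra_simps)
  finally show ?thesis ..
qed

text \<open>Away from \<open>k0\<close> box and cube have the same edge \<open>2 * r\<close>, so the
  volume polynomial factors. For \<open>i \<ge> 1\<close> the coefficient of \<open>s ^ i\<close>
  contains \<open>d\<close> times a positive binomial coefficient, and what remains is
  nonnegative.\<close>

lemma mixed_volume_box_cube:
  fixes lo hi :: "real^'n"
  assumes V: "mixed_volume_functional V" and r: "0 < r" and d: "0 < d"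
    and k0: "hi $ k0 - lo $ k0 = d" and rest: "\<And>j. j \<noteq> k0 \<Longrightarrow> hi $ j - lo $ j = 2 * r"
    and i: "1 \<le> i" "i \<le> CARD('n)"
  shows "(2 * r) ^ (CARD('n) - 1) * d \<le> real (CARD('n) choose i) *
    V (replicate i (cbox lo hi) @ replicate (CARD('n) - i) (cbox (\<chi> i. - r) (\<chi> i. r)))"
proof -
  let ?C = "cbox lo hi" and ?Q = "cbox (\<chi> i. - r) (\<chi> i. r) :: (real^'n) set"
  define m where "m = CARD('n) - 1"
  have n: "CARD('n) = Suc m"
    by (simp add: m_def)
  have lohi: "lo $ j < hi $ j" for j
    using k0 rest[of j] r d by (cases "j = k0") auto
  have body: "convex_body ?C" "convex_body ?Q"
    using lohi r by (auto intro!: convex_body_cbox_cart)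
  let ?a = "\<lambda>k. real (CARD('n) choose k) * V (replicate k ?C @ replicate (CARD('n) - k) ?Q)"
  let ?b = "\<lambda>k. (2 * r) ^ m * (d * (if k = 0 then 0 else real (m choose (k - 1))) + 2 * r * real (m choose k))"
  have poly: "(\<Sum>k\<le>CARD('n). ?a k * s ^ k) = (\<Sum>k\<le>CARD('n). ?b k * s ^ k)" if "0 \<le> s" for s
  proof -
    let ?K = "\<lambda>j :: nat. if j = 0 then ?C else ?Q"
    let ?u = "\<chi> i. s * hi $ i + r" and ?l = "\<chi> i. s * lo $ i - r"
    have le: "?l $ j \<le> ?u $ j" for j
      using mult_left_mono[OF less_imp_le[OF lohi[of j]] that] r by simp
    have "(\<Sum>k\<le>CARD('n). ?a k * s ^ k) = measure lebesgue (minkowski_combination 2 (\<lambda>j. if j = 0 then s else 1) ?K)"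
      using mixed_volume_functional_two_bodies[OF V, of ?K s] body that by simp
    also have "\<dots> = measure lebesgue (cbox ?l ?u)"
      using lohi r that by (subst minkowski_combination_boxes) (auto intro: less_imp_le)
    also have "\<dots> = (\<Prod>j\<in>UNIV. ?u $ j - ?l $ j)"
      using le by (simp add: content_cbox_cart interval_ne_empty_cart)
    also have "\<dots> = (?u $ k0 - ?l $ k0) * (\<Prod>j\<in>UNIV - {k0}. ?u $ j - ?l $ j)"
      by (rule prod.remove) auto
    also have "?u $ k0 - ?l $ k0 = s * d + 2 * r"
      by (simp add: k0[symmetric] algebra_simps)
    also have "(\<Prod>j\<in>UNIV - {k0}. ?u $ j - ?l $ j) = (\<Prod>j\<in>UNIV - {k0}. 2 * r * (s + 1))"
    proof (rule prod.cong[OF refl])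
      fix j assume "j \<in> UNIV - {k0}"
      then have "hi $ j = lo $ j + 2 * r"
        using rest[of j] by simp
      then show "?u $ j - ?l $ j = 2 * r * (s + 1)"
        by (simp add: algebra_simps)
    qed
    also have "\<dots> = (2 * r * (s + 1)) ^ m"
      by (simp add: m_def)
    also have "(s * d + 2 * r) * (2 * r * (s + 1)) ^ m = (\<Sum>k\<le>CARD('n). ?b k * s ^ k)"
      unfolding n by (rule binomial_linear_expansion)
    finally show ?thesis .
  qed
  have "(2 * r) ^ m * d \<le> ?b i"
  proof -
    have "0 < m choose (i - 1)"
      using i n by simp
    then have "1 \<le> real (m choose (i - 1))"
      by linarith
    then have "d * 1 + 0 \<le> d * (if i = 0 then 0 else real (m choose (i - 1))) + 2 * r * real (m choose i)"
      using i r d by (intro add_mono mult_left_mono) auto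
    then show ?thesis
      using r by (intro mult_left_mono) auto
  qed
  also have "?b i = ?a i"
    using polynomial_coeffs_eq_on_nonneg[where a = ?a and b = ?b, OF poly i(2)] by simp
  finally show ?thesis
    by (simp add: m_def)
qed

subsection \<open>Projective maps degenerating on a supporting hyperplane\<close>

text \<open>As \<open>\<epsilon>\<close> tends to 0 the singular hyperplane approaches the one through \<open>p\<close> with normal \<open>u\<close>,
  and the image of \<open>p\<close>, namely \<open>e / \<epsilon>\<close>, goes to infinity.\<close>
definition projective_map :: "'a::real_inner \<Rightarrow> 'a \<Rightarrow> 'a \<Rightarrow> real \<Rightarrow> 'a \<Rightarrow> 'a" where
  "projective_map p u e \<epsilon> x = (x - p + e) /\<^sub>R (\<epsilon> + (p - x) \<bullet> u)"

lemma sum_UNIV_option: "(\<Sum>j\<in>(UNIV :: 'n::finite option set). f j) = f None + (\<Sum>i\<in>UNIV. f (Some i))"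
  by (simp add: UNIV_option_conv sum.reindex)

text \<open>The Schur complement of the identity block is \<open>1 + \<epsilon>\<close>, thanks to
  \<open>e \<bullet> u = 1\<close>. In the proof it appears when the kernel equations are
  solved.\<close>

lemma fractional_linear_map_projective_map:
  fixes p u e :: "real^'n"
  assumes eu: "e \<bullet> u = 1" and \<epsilon>: "0 < \<epsilon>"
  shows "fractional_linear_map {x. 0 < \<epsilon> + (p - x) \<bullet> u} (projective_map p u e \<epsilon>)"
proof -
  let ?B = "block_matrix (mat 1) (e - p) (- u) (\<epsilon> + p \<bullet> u)"
  have den: "x \<bullet> (- u) + (\<epsilon> + p \<bullet> u) = \<epsilon> + (p - x) \<bullet> u" for x
    by (simp add: inner_diff_left)
  have "X = 0" if X: "?B *v X = 0" for X
  proof -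
    define y s where "y = (\<chi> i. X $ Some i)" and "s = X $ None"
    have "(?B *v X) $ Some i = y $ i + s * (e - p) $ i" for i
      by (simp add: matrix_vector_mult_def sum_UNIV_option block_matrix_def y_def s_def mat_def
          if_distrib[where f = "\<lambda>c. c * _"] cong: if_cong)
    then have y: "y = - s *\<^sub>R (e - p)"
      using X by (simp add: vec_eq_iff add_eq_0_iff)
    have "(?B *v X) $ None = - (u \<bullet> y) + (\<epsilon> + p \<bullet> u) * s"
      by (simp add: matrix_vector_mult_def sum_UNIV_option block_matrix_def y_def s_def inner_vec_def
          sum_negf)
    then have "- (u \<bullet> y) + (\<epsilon> + p \<bullet> u) * s = 0"
      using X by simp
    then have "s * (1 + \<epsilon>) = 0"
      using eu by (simp add: y inner_diff_right inner_commute algebra_simps)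
    then have "s = 0"
      using \<epsilon> by simp
    with y have "y = 0"
      by simp
    have "X $ j = 0" for j
      using \<open>s = 0\<close> \<open>y = 0\<close> by (cases j) (auto simp: s_def y_def vec_eq_iff)
    then show ?thesis
      by (simp add: vec_eq_iff)
  qed
  then have "invertible ?B"
    by (metis invertible_left_inverse matrix_left_invertible_ker)
  moreover have "- u \<noteq> 0"
    using eu by auto
  moreover have "mat 1 *v x + (e - p) = x - p + e" for x
    by simp
  ultimately show ?thesis
    unfolding fractional_linear_map_def projective_map_def
    by (intro exI[of _ "mat 1"] exI[of _ "e - p"] exI[of _ "- u"] exI[of _ "\<epsilon> + p \<bullet> u"] conjI)
      (simp_all only: den if_False simp_thms HOL.refl ball_triv Ball_def)
qed

text \<open>The inner product with \<open>u\<close> recovers the denominator \<open>h\<close> from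
  the image, through \<open>h * (1 + y \<bullet> u) = 1 + \<epsilon>\<close>. This yields
  injectivity.\<close>

lemma projective_map_inverse:
  assumes eu: "e \<bullet> u = 1" and x: "0 < \<epsilon> + (p - x) \<bullet> u" and \<epsilon>: "0 < \<epsilon>"
  defines "y \<equiv> projective_map p u e \<epsilon> x"
  shows "x = ((1 + \<epsilon>) / (1 + y \<bullet> u)) *\<^sub>R y + p - e"
proof -
  define h where "h = \<epsilon> + (p - x) \<bullet> u"
  have h: "0 < h"
    using x by (simp add: h_def)
  have hy: "h *\<^sub>R y = x - p + e"
    using h by (simp add: y_def projective_map_def h_def[symmetric])
  then have "(h *\<^sub>R y) \<bullet> u = (x - p + e) \<bullet> u"
    by simp
  then have "h * (y \<bullet> u) = 1 + \<epsilon> - h"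
    using eu by (simp add: h_def inner_diff_left inner_add_left)
  then have hs: "h * (1 + y \<bullet> u) = 1 + \<epsilon>"
    by (simp add: algebra_simps)
  then have "1 + y \<bullet> u \<noteq> 0"
    using \<epsilon> by auto
  then have "(1 + \<epsilon>) / (1 + y \<bullet> u) = h"
    using hs by (simp add: field_simps)
  then show ?thesis
    by (simp add: hy)
qed

text \<open>Segments go to segments, but reparametrised: dividing the weights \<open>a\<close> and
  \<open>b\<close> by the denominators at the end points gives, after normalisation, the preimage of
  the convex combination.\<close>

lemma convex_projective_map_image:
  assumes K: "convex K" and dom: "\<And>x. x \<in> K \<Longrightarrow> 0 < \<epsilon> + (p - x) \<bullet> u"
  shows "convex (projective_map p u e \<epsilon> ` K)"
proof (rule convexI)
  fix y1 y2 and a b :: real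
  assume "y1 \<in> projective_map p u e \<epsilon> ` K" "y2 \<in> projective_map p u e \<epsilon> ` K"
    and ab: "0 \<le> a" "0 \<le> b" "a + b = 1"
  then obtain x y where x: "x \<in> K" "y1 = projective_map p u e \<epsilon> x"
    and y: "y \<in> K" "y2 = projective_map p u e \<epsilon> y"
    by blast
  define h where "h z = \<epsilon> + (p - z) \<bullet> u" for z
  have h: "0 < h x" "0 < h y"
    using dom x y by (auto simp: h_def)
  define s t where "s = a / h x" and "t = b / h y"
  have st: "0 \<le> s" "0 \<le> t" "s * h x = a" "t * h y = b"
    using h ab by (auto simp: s_def t_def)
  have "s \<noteq> 0 \<or> t \<noteq> 0"
    using st(3,4) ab(3) by auto
  then have "0 < s + t"
    using st(1,2) by linarith
  define z where "z = (s / (s + t)) *\<^sub>R x + (t / (s + t)) *\<^sub>R y"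
  have "z \<in> K"
    unfolding z_def using x y st \<open>0 < s + t\<close>
    by (intro convexD[OF K]) (auto simp: add_divide_distrib[symmetric])
  have stz: "(s + t) *\<^sub>R z = s *\<^sub>R x + t *\<^sub>R y"
    using \<open>0 < s + t\<close> by (simp add: z_def scaleR_add_right)
  have "(s + t) * h z = (s + t) * (\<epsilon> + p \<bullet> u) - ((s + t) *\<^sub>R z) \<bullet> u"
    by (simp add: h_def inner_diff_left algebra_simps)
  also have "\<dots> = s * h x + t * h y"
    unfolding stz by (simp add: h_def inner_diff_left inner_add_left algebra_simps)
  finally have "(s + t) * h z = 1"
    using st ab by simp
  then have "inverse (h z) = s + t"
    by (metis inverse_unique mult.commute)
  then have "projective_map p u e \<epsilon> z = (s + t) *\<^sub>R (z - p + e)"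
    by (simp only: projective_map_def h_def[symmetric])
  also have "\<dots> = (s + t) *\<^sub>R z + (s + t) *\<^sub>R (e - p)"
    by (simp add: algebra_simps)
  also have "\<dots> = s *\<^sub>R (x - p + e) + t *\<^sub>R (y - p + e)"
    unfolding stz by (simp add: algebra_simps)
  also have "\<dots> = a *\<^sub>R y1 + b *\<^sub>R y2"
    by (simp add: x y projective_map_def h_def[symmetric] s_def t_def divide_inverse)
  finally show "a *\<^sub>R y1 + b *\<^sub>R y2 \<in> projective_map p u e \<epsilon> ` K"
    using \<open>z \<in> K\<close> by (metis image_eqI)
qed

text \<open>The interior of the image is nonempty by invariance of domain, as the map is continuous
  and injective on \<open>K\<close>.\<close>

lemma convex_body_projective_map_image:
  fixes K :: "'a::euclidean_space set"
  assumes K: "convex_body K" and eu: "e \<bullet> u = 1" and \<epsilon>: "0 < \<epsilon>"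
    and dom: "\<And>x. x \<in> K \<Longrightarrow> 0 < \<epsilon> + (p - x) \<bullet> u"
  shows "convex_body (projective_map p u e \<epsilon> ` K)"
proof -
  let ?F = "projective_map p u e \<epsilon>"
  have cont: "continuous_on K ?F"
    unfolding projective_map_def[abs_def] using dom
    by (intro continuous_on_scaleR continuous_on_inverse continuous_intros) (metis less_irrefl)
  have inj: "inj_on ?F K"
    by (rule inj_onI) (metis projective_map_inverse[OF eu dom \<epsilon>])
  have "open (?F ` interior K)"
    using cont inj interior_subset[of K]
    by (intro invariance_of_domain) (auto intro: continuous_on_subset inj_on_subset)
  then have "?F ` interior K \<subseteq> interior (?F ` K)"
    by (intro interior_maximal image_mono interior_subset)
  then show ?thesis
    using K convex_projective_map_image[OF _ dom] compact_continuous_image[OF cont]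
    unfolding convex_body_def by fastforce
qed

text \<open>For \<open>\<epsilon> = 0\<close> the point \<open>p + t *\<^sub>R (a - p)\<close> would
  go to \<open>(a - p) /\<^sub>R \<delta> + (1 / (t * \<delta>)) *\<^sub>R e\<close>: the segment
  from \<open>p\<close> to \<open>a\<close> becomes a ray in direction \<open>e\<close>, and the
  image of the cone over the ball about \<open>a\<close> contains a half-cylinder around a part of
  it. Up to a prescribed length \<open>N\<close> a small positive \<open>\<epsilon>\<close> disturbs
  this little, with \<open>r\<close> and \<open>\<tau>0\<close> independent of
  \<open>N\<close>.\<close>

lemma projective_map_cylinder:
  fixes A :: "'a::euclidean_space set"
  assumes A: "convex A" "p \<in> A" "cball a \<rho> \<subseteq> A" and \<rho>: "0 < \<rho>" and eu: "e \<bullet> u = 1"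
    and \<delta>: "0 < (p - a) \<bullet> u"
  obtains r \<tau>0 where "0 < r" "r \<le> 1" "0 \<le> \<tau>0"
    "\<And>N. 0 \<le> N \<Longrightarrow> \<exists>\<epsilon>>0. \<forall>\<tau> z. \<tau>0 \<le> \<tau> \<and> \<tau> \<le> \<tau>0 + N \<and> norm z \<le> r \<longrightarrow>
       \<tau> *\<^sub>R e + (a - p) /\<^sub>R ((p - a) \<bullet> u) + z \<in> projective_map p u e \<epsilon> ` A"
proof -
  define \<delta> where "\<delta> = (p - a) \<bullet> u"
  have \<delta>: "0 < \<delta>"
    using assms by (simp add: \<delta>_def)
  have "e \<noteq> 0" "u \<noteq> 0"
    using eu by auto
  then have e: "0 < norm e" and u: "0 < norm u"
    by auto
  \<comment> \<open>The displacement \<open>(\<tau> - s) *\<^sub>R e + z\<close> below must have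
    norm at most \<open>\<rho> / \<delta>\<close>; \<open>r\<close> and \<open>\<eta>\<close> each
    account for half of it. The bound \<open>1 / norm u\<close> keeps \<open>z \<bullet> u\<close>
    between -1 and 1.\<close>
  define r where "r = min 1 (min (1 / norm u) (\<rho> / (2 * \<delta> * (norm u * norm e + 1))))"
  define \<eta> where "\<eta> = \<rho> / (2 * \<delta> * norm e)"
  \<comment> \<open>The 1 makes up for a negative \<open>z \<bullet> u\<close>; the rest ensures
    \<open>s \<ge> 1 / \<delta>\<close> when \<open>\<epsilon> \<le> 1\<close>, so that
    \<open>t \<le> 1\<close>.\<close>
  define \<tau>0 where "\<tau>0 = 2 / \<delta> + 1"
  have c: "0 < norm u * norm e + 1"
    using e u by (simp add: add_pos_pos)
  have r: "0 < r" "r \<le> 1"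
    using \<rho> \<delta> c u by (simp_all add: r_def)
  have r_u: "r * norm u \<le> 1"
  proof -
    have "r * norm u \<le> 1 / norm u * norm u"
      using u by (intro mult_right_mono) (auto simp: r_def)
    then show ?thesis
      using u by simp
  qed
  have r_c: "r * (norm u * norm e + 1) \<le> \<rho> / (2 * \<delta>)"
  proof -
    have "r * (norm u * norm e + 1) \<le> \<rho> / (2 * \<delta> * (norm u * norm e + 1)) * (norm u * norm e + 1)"
      using c by (intro mult_right_mono) (auto simp: r_def)
    then show ?thesis
      using c by simp
  qed
  have \<eta>: "0 < \<eta>" "\<eta> * norm e = \<rho> / (2 * \<delta>)"
    using \<rho> \<delta> e by (simp_all add: \<eta>_def)
  have \<tau>0: "0 < \<tau>0"
    using \<delta> by (simp add: \<tau>0_def add_pos_pos)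
  show ?thesis
  proof (rule that[of r \<tau>0])
    fix N :: real assume N: "0 \<le> N"
    define \<epsilon> where "\<epsilon> = min 1 (\<eta> / (\<tau>0 + N))"
    have \<epsilon>: "0 < \<epsilon>" "\<epsilon> \<le> 1"
      using \<eta> \<tau>0 N by (simp_all add: \<epsilon>_def)
    have "\<tau> *\<^sub>R e + (a - p) /\<^sub>R ((p - a) \<bullet> u) + z \<in> projective_map p u e \<epsilon> ` A"
      if \<tau>: "\<tau>0 \<le> \<tau>" "\<tau> \<le> \<tau>0 + N" and z: "norm z \<le> r" for \<tau> z
    proof -
      define y where "y = \<tau> *\<^sub>R e + (a - p) /\<^sub>R \<delta> + z"
      have zu: "\<bar>z \<bullet> u\<bar> \<le> r * norm u"
        by (rule order_trans[OF Cauchy_Schwarz_ineq2]) (use z in \<open>simp add: mult_right_mono\<close>)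
      have yu: "y \<bullet> u = \<tau> - 1 + z \<bullet> u"
      proof -
        have "(a - p) \<bullet> u = - \<delta>"
          by (simp add: \<delta>_def inner_diff_left)
        then show ?thesis
          using eu \<delta> by (simp add: y_def inner_add_left)
      qed
      \<comment> \<open>The reciprocal of the denominator at the preimage of \<open>y\<close>, since
        \<open>1 + y \<bullet> u = \<tau> + z \<bullet> u\<close>.\<close>
      define s where "s = (\<tau> + z \<bullet> u) / (1 + \<epsilon>)"
      have s_eq: "s * (1 + \<epsilon>) = \<tau> + z \<bullet> u"
        using \<epsilon> by (simp add: s_def)
      have "(1 / \<delta>) * (1 + \<epsilon>) \<le> (1 / \<delta>) * 2"
        using \<delta> \<epsilon> by (intro mult_left_mono) auto
      also have "\<dots> \<le> \<tau> + z \<bullet> u"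
        using \<tau>(1) zu r_u by (simp add: \<tau>0_def)
      finally have s_ge: "1 / \<delta> \<le> s"
        using \<epsilon> by (simp add: s_def pos_le_divide_eq)
      then have s: "0 < s"
        using \<delta> by (metis divide_pos_pos less_le_trans zero_less_one)
      define t where "t = 1 / (s * \<delta>)"
      have t: "0 \<le> t" "t \<le> 1" "t * \<delta> = 1 / s"
        using s s_ge \<delta> by (simp_all add: t_def field_simps)
      \<comment> \<open>The preimage is the point at parameter \<open>t\<close> on the segment from
        \<open>p\<close> to \<open>q\<close>. It lies in \<open>A\<close> because \<open>q\<close>
        is near \<open>a\<close>: both \<open>\<epsilon> * \<tau>\<close> and
        \<open>z \<bullet> u\<close> are small, and they control \<open>\<tau> - s\<close>.\<close>
      define q where "q = a + \<delta> *\<^sub>R ((\<tau> - s) *\<^sub>R e + z)"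
      have \<epsilon>\<tau>: "\<epsilon> * \<tau> \<le> \<eta>" "0 \<le> \<epsilon> * \<tau>"
      proof -
        have "\<epsilon> * \<tau> \<le> \<eta> / (\<tau>0 + N) * (\<tau>0 + N)"
          using \<tau> \<tau>0 \<epsilon> N \<eta> by (intro mult_mono) (auto simp: \<epsilon>_def)
        then show "\<epsilon> * \<tau> \<le> \<eta>"
          using \<tau>0 N by simp
        show "0 \<le> \<epsilon> * \<tau>"
          using \<epsilon> \<tau> \<tau>0 by simp
      qed
      have "(\<tau> - s) * (1 + \<epsilon>) = \<epsilon> * \<tau> - z \<bullet> u"
        using s_eq by (simp add: algebra_simps)
      then have "\<bar>\<tau> - s\<bar> * (1 + \<epsilon>) = \<bar>\<epsilon> * \<tau> - z \<bullet> u\<bar>"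
        using \<epsilon> by (metis abs_mult abs_of_pos add_pos_pos zero_less_one)
      also have "\<dots> \<le> \<eta> + r * norm u"
        using \<epsilon>\<tau> zu by linarith
      finally have "\<bar>\<tau> - s\<bar> * (1 + \<epsilon>) \<le> \<eta> + r * norm u" .
      moreover have "\<bar>\<tau> - s\<bar> * 1 \<le> \<bar>\<tau> - s\<bar> * (1 + \<epsilon>)"
        using \<epsilon> by (intro mult_left_mono) auto
      ultimately have ts: "\<bar>\<tau> - s\<bar> \<le> \<eta> + r * norm u"
        by simp
      have "norm ((\<tau> - s) *\<^sub>R e + z) \<le> \<bar>\<tau> - s\<bar> * norm e + norm z"
        by (rule order_trans[OF norm_triangle_ineq]) simp
      also have "\<dots> \<le> (\<eta> + r * norm u) * norm e + r"
        using ts z by (intro add_mono mult_right_mono) auto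
      also have "\<dots> = \<eta> * norm e + r * (norm u * norm e + 1)"
        by (simp add: algebra_simps)
      also have "\<dots> \<le> \<rho> / \<delta>"
        using \<eta>(2) r_c by (simp add: field_simps)
      finally have "\<delta> * norm ((\<tau> - s) *\<^sub>R e + z) \<le> \<rho>"
        using \<delta> by (simp add: field_simps)
      then have "q \<in> A"
        using A(3) \<delta> by (auto simp: q_def dist_norm)
      define x where "x = p + t *\<^sub>R (q - p)"
      have "x = (1 - t) *\<^sub>R p + t *\<^sub>R q"
        by (simp add: x_def algebra_simps)
      then have "x \<in> A"
        using convexD_alt[OF A(1) A(2) \<open>q \<in> A\<close> t(1,2)] by simp
      have qp: "q - p = \<delta> *\<^sub>R (y - s *\<^sub>R e)"
        using \<delta> by (simp add: q_def y_def algebra_simps)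
      have xp: "x - p = y /\<^sub>R s - e"
      proof -
        have "x - p = (t * \<delta>) *\<^sub>R (y - s *\<^sub>R e)"
          by (simp add: x_def qp)
        then show ?thesis
          using s by (simp add: t(3) scaleR_diff_right divide_inverse)
      qed
      have "\<epsilon> + (p - x) \<bullet> u = \<epsilon> - (x - p) \<bullet> u"
        by (simp add: inner_diff_left)
      also have "\<dots> = 1 + \<epsilon> - (y \<bullet> u) / s"
        using eu by (simp add: xp inner_diff_left divide_inverse mult.commute)
      also have "\<dots> = 1 / s"
        using s s_eq by (simp add: yu field_simps)
      finally have "projective_map p u e \<epsilon> x = y"
        using s by (simp add: projective_map_def xp)
      then have "y \<in> projective_map p u e \<epsilon> ` A"
        using \<open>x \<in> A\<close> by blast
      then show ?thesis
        by (simp only: y_def \<delta>_def)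
    qed
    then show "\<exists>\<epsilon>>0. \<forall>\<tau> z. \<tau>0 \<le> \<tau> \<and> \<tau> \<le> \<tau>0 + N \<and> norm z \<le> r \<longrightarrow>
       \<tau> *\<^sub>R e + (a - p) /\<^sub>R ((p - a) \<bullet> u) + z \<in> projective_map p u e \<epsilon> ` A"
      using \<epsilon>(1) by blast
  qed (use r \<tau>0 in auto)
qed

section \<open>Contradiction from a point of \<open>A\<close> outside \<open>B\<close>\<close>

theorem theorem1p2:
  fixes A B :: "(real^'n) set" and i :: nat
  assumes "CARD('n) \<ge> 2"
    and "convex_body A" and "convex_body B"
    and "1 \<le> i" and "i \<le> CARD('n)"
    and "\<And>D F. fractional_linear_map D F \<Longrightarrow> A \<subseteq> D \<Longrightarrow> B \<subseteq> D \<Longrightarrow>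
           quermassintegral (CARD('n) - i) (F ` A) \<le> quermassintegral (CARD('n) - i) (F ` B)"
  shows "A \<subseteq> B"
proof (rule ccontr)
  assume "\<not> A \<subseteq> B"
  then obtain a0 where a0: "a0 \<in> A" "a0 \<notin> B"
    by blast
  have A: "compact A" "convex A" "interior A \<noteq> {}" and B: "compact B" "convex B"
    using assms(2,3) by (auto simp: convex_body_def)
  obtain u0 :: "real^'n" and b0 where sep0: "u0 \<bullet> a0 < b0" "\<And>x. x \<in> B \<Longrightarrow> b0 < u0 \<bullet> x"
    using separating_hyperplane_closed_point[OF B(2) compact_imp_closed[OF B(1)] a0(2)] by blast
  define u where "u = - u0"
  have sep: "x \<bullet> u < - b0" if "x \<in> B" for x
    using sep0(2)[OF that] by (simp add: u_def inner_commute)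
  have "B \<noteq> {}"
    using assms(3) interior_subset by (auto simp: convex_body_def)
  then have "u \<noteq> 0"
    using sep0 by (auto simp: u_def)
  then obtain k0 where uk: "u $ k0 \<noteq> 0"
    by (auto simp: vec_eq_iff)
  \<comment> \<open>A coordinate direction scaled to \<open>e \<bullet> u = 1\<close>, so that
    cylinders along \<open>e\<close> contain coordinate boxes.\<close>
  define e where "e = axis k0 (1 / u $ k0)"
  have eu: "e \<bullet> u = 1"
    using uk by (simp add: e_def inner_axis')
  have "continuous_on A (\<lambda>x. x \<bullet> u)"
    by (intro continuous_intros)
  then obtain p where p: "p \<in> A" "\<And>x. x \<in> A \<Longrightarrow> x \<bullet> u \<le> p \<bullet> u"
    using continuous_attains_sup[OF A(1)] a0(1) by blast
  \<comment> \<open>A lower bound for the gap between \<open>B\<close> and the supporting hyperplane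
    at \<open>p\<close>, hence for the denominators on \<open>B\<close>, whatever
    \<open>\<epsilon> > 0\<close> is.\<close>
  define \<beta> where "\<beta> = p \<bullet> u + b0"
  have \<beta>: "0 < \<beta>"
    using p(2)[OF a0(1)] sep0(1) by (simp add: \<beta>_def u_def inner_commute)
  have \<beta>_le: "\<beta> \<le> (p - x) \<bullet> u" if "x \<in> B" for x
    using sep[OF that] by (simp add: \<beta>_def inner_diff_left)
  obtain a \<rho> where a: "0 < \<rho>" "cball a \<rho> \<subseteq> A"
    using A(3) mem_interior_cball by blast
  have \<delta>: "0 < (p - a) \<bullet> u"
  proof -
    have "a + \<rho> *\<^sub>R sgn u \<in> A"
      using a by (auto simp: dist_norm norm_sgn)
    then have "(a + \<rho> *\<^sub>R sgn u) \<bullet> u \<le> p \<bullet> u"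
      by (rule p(2))
    moreover have "0 < \<rho> * (sgn u \<bullet> u)"
      using a(1) \<open>u \<noteq> 0\<close> by (simp add: sgn_div_norm)
    ultimately show ?thesis
      by (simp add: inner_add_left inner_diff_left)
  qed
  obtain r \<tau>0 where r: "0 < r" "r \<le> 1" and \<tau>0: "0 \<le> \<tau>0"
    and cyl: "\<And>N. 0 \<le> N \<Longrightarrow> \<exists>\<epsilon>>0. \<forall>\<tau> z. \<tau>0 \<le> \<tau> \<and> \<tau> \<le> \<tau>0 + N \<and> norm z \<le> r \<longrightarrow>
       \<tau> *\<^sub>R e + (a - p) /\<^sub>R ((p - a) \<bullet> u) + z \<in> projective_map p u e \<epsilon> ` A"
    using projective_map_cylinder[OF A(2) p(1) a(2,1) eu \<delta>] by metis
  define z0 where "z0 = (a - p) /\<^sub>R ((p - a) \<bullet> u)"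
  \<comment> \<open>A vector with entries of absolute value at most \<open>q\<close> has norm at
    most \<open>r\<close>. So a cube of half edge \<open>q\<close> fits into the unit ball and into
    the balls of radius \<open>r\<close> of the cylinder.\<close>
  define q where "q = r / CARD('n)"
  have q: "0 < q" "CARD('n) * q = r"
    using r by (simp_all add: q_def)
  have norm_le: "norm z \<le> r" if "\<And>j. \<bar>z $ j\<bar> \<le> q" for z :: "real^'n"
  proof -
    have "norm z \<le> (\<Sum>j\<in>UNIV. \<bar>z $ j\<bar>)"
      by (rule norm_le_l1_cart)
    also have "\<dots> \<le> (\<Sum>j\<in>(UNIV :: 'n set). q)"
      using that by (intro sum_mono)
    finally show ?thesis
      using q by simp
  qed
  obtain M where M: "0 < M" "\<And>x. x \<in> B \<Longrightarrow> norm (x - p + e) \<le> M"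
  proof -
    have "bounded ((\<lambda>x. x - p + e) ` B)"
      by (intro compact_imp_bounded compact_continuous_image B continuous_intros)
    then obtain M where "0 < M" "\<forall>y\<in>(\<lambda>x. x - p + e) ` B. norm y \<le> M"
      using bounded_pos by blast
    then show ?thesis
      using that by blast
  qed
  define R where "R = M / \<beta>"
  have R: "0 < R"
    using M \<beta> by (simp add: R_def)
  let ?V = "mixed_volume :: (real^'n) set list \<Rightarrow> real" and ?n = "CARD('n)"
  let ?D = "cball 0 1 :: (real^'n) set" and ?Q = "cbox (\<chi> i. - q) (\<chi> i. q) :: (real^'n) set"
  have V: "mixed_volume_functional ?V"
    by (rule mixed_volume_functional_mixed_volume)
  have quermass: "quermassintegral (?n - i) K = ?V (replicate i K @ replicate (?n - i) ?D)"
    for K :: "(real^'n) set"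
    using assms(5) by (simp add: quermassintegral_def)
  define W where "W = ?V (replicate i (cball 0 R) @ replicate (?n - i) ?D)"
  \<comment> \<open>The edge length that forces the mixed volume of box and cube up to at least
    \<open>\<bar>W\<bar> + 1\<close>. As \<open>W\<close> does not involve
    \<open>\<epsilon>\<close>, it can be chosen before \<open>\<epsilon>\<close>.\<close>
  define d where "d = (real (?n choose i) * (\<bar>W\<bar> + 1)) / (2 * q) ^ (?n - 1)"
  have "0 < real (?n choose i)"
    using assms(5) by simp
  then have d: "0 < d" "(2 * q) ^ (?n - 1) * d = real (?n choose i) * (\<bar>W\<bar> + 1)"
    using q(1) by (simp_all add: d_def)
  \<comment> \<open>Raising \<open>\<tau>\<close> by 1 moves coordinate \<open>k0\<close> by
    \<open>1 / u $ k0\<close>, so an edge \<open>d\<close> takes a parameter range of length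
    \<open>d * \<bar>u $ k0\<bar>\<close>.\<close>
  define N where "N = d * \<bar>u $ k0\<bar>"
  have "0 \<le> N"
    using d(1) by (simp add: N_def)
  from cyl[OF this] obtain \<epsilon> where \<epsilon>: "0 < \<epsilon>"
    and sub: "\<And>\<tau> z. \<tau>0 \<le> \<tau> \<Longrightarrow> \<tau> \<le> \<tau>0 + N \<Longrightarrow> norm z \<le> r \<Longrightarrow>
      \<tau> *\<^sub>R e + z0 + z \<in> projective_map p u e \<epsilon> ` A"
    unfolding z0_def by blast
  let ?F = "projective_map p u e \<epsilon>"
  \<comment> \<open>The sign of \<open>u $ k0\<close> decides which end of the parameter range is
    the lower end of the edge.\<close>
  define c0 c1 where "c0 = min (\<tau>0 / u $ k0) ((\<tau>0 + N) / u $ k0)"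
    and "c1 = max (\<tau>0 / u $ k0) ((\<tau>0 + N) / u $ k0)"
  define lo hi where "lo = (\<chi> j. z0 $ j + (if j = k0 then c0 else - q))"
    and "hi = (\<chi> j. z0 $ j + (if j = k0 then c1 else q))"
  have "(\<tau>0 + N) / u $ k0 = \<tau>0 / u $ k0 + (if 0 < u $ k0 then d else - d)"
    using uk by (simp add: N_def add_divide_distrib abs_if)
  then have c01: "c1 - c0 = d"
    using d(1) by (simp add: c0_def c1_def)
  have inside: "cbox lo hi \<subseteq> ?F ` A"
  proof
    fix y assume "y \<in> cbox lo hi"
    then have y: "lo $ j \<le> y $ j" "y $ j \<le> hi $ j" for j
      by (simp_all add: mem_box_cart)
    \<comment> \<open>The parameter is read off coordinate \<open>k0\<close>, where \<open>z\<close>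
      then vanishes.\<close>
    define \<tau> where "\<tau> = (y $ k0 - z0 $ k0) * u $ k0"
    define z where "z = y - z0 - \<tau> *\<^sub>R e"
    have "c0 \<le> y $ k0 - z0 $ k0" "y $ k0 - z0 $ k0 \<le> c1"
      using y[of k0] by (simp_all add: lo_def hi_def)
    then have \<tau>: "\<tau>0 \<le> \<tau>" "\<tau> \<le> \<tau>0 + N"
      using uk \<open>0 \<le> N\<close> unfolding \<tau>_def c0_def c1_def
      by (cases "0 < u $ k0"; simp add: min_def max_def field_simps split: if_splits)+
    have "\<bar>z $ j\<bar> \<le> q" for j
      using y[of j] q(1) uk by (cases "j = k0") (auto simp: z_def \<tau>_def e_def lo_def hi_def axis_def)
    then have "norm z \<le> r"
      by (rule norm_le)
    from sub[OF \<tau> this] show "y \<in> ?F ` A"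
      by (simp add: z_def)
  qed
  have domA: "0 < \<epsilon> + (p - x) \<bullet> u" if "x \<in> A" for x
    using p(2)[OF that] \<epsilon> by (simp add: inner_diff_left)
  have domB: "0 < \<epsilon> + (p - x) \<bullet> u" if "x \<in> B" for x
    using \<beta>_le[OF that] \<beta> \<epsilon> by simp
  have bodies: "convex_body (?F ` A)" "convex_body (?F ` B)"
    using convex_body_projective_map_image[OF assms(2) eu \<epsilon> domA]
      convex_body_projective_map_image[OF assms(3) eu \<epsilon> domB] by blast+
  have ball: "convex_body (cball 0 t :: (real^'n) set)" if "0 < t" for t
    using that by (simp add: convex_body_def)
  have FB: "?F ` B \<subseteq> cball 0 R"
  proof safe
    fix x assume x: "x \<in> B"
    have "norm (?F x) = norm (x - p + e) / (\<epsilon> + (p - x) \<bullet> u)"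
      using domB[OF x] by (simp add: projective_map_def divide_inverse mult.commute)
    also have "\<dots> \<le> M / \<beta>"
      using M x \<beta> \<beta>_le[OF x] \<epsilon> by (intro frac_le) auto
    finally show "?F x \<in> cball 0 R"
      by (simp add: R_def)
  qed
  have boxes: "convex_body (cbox lo hi)" "convex_body ?Q"
    using c01 d(1) q(1) by (auto intro!: convex_body_cbox_cart simp: lo_def hi_def)
  have "?Q \<subseteq> ?D"
  proof
    fix z :: "real^'n" assume "z \<in> ?Q"
    then have "norm z \<le> r"
      by (intro norm_le) (auto simp: mem_box_cart abs_le_iff minus_le_iff)
    then show "z \<in> ?D"
      using r by simp
  qed
  have "real (?n choose i) * (\<bar>W\<bar> + 1) \<le> real (?n choose i) *
      ?V (replicate i (cbox lo hi) @ replicate (?n - i) ?Q)"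
    using mixed_volume_box_cube[OF V q(1) d(1), of hi k0 lo i] assms(4,5) c01 unfolding d(2)
    by (simp add: lo_def hi_def)
  then have "\<bar>W\<bar> + 1 \<le> ?V (replicate i (cbox lo hi) @ replicate (?n - i) ?Q)"
    using \<open>0 < real (?n choose i)\<close> by simp
  also have "\<dots> \<le> ?V (replicate i (?F ` A) @ replicate (?n - i) ?D)"
    using boxes bodies ball \<open>?Q \<subseteq> ?D\<close> inside assms(5) by (intro mixed_volume_functional_mono[OF V]) auto
  also have "\<dots> \<le> ?V (replicate i (?F ` B) @ replicate (?n - i) ?D)"
    using assms(6)[OF fractional_linear_map_projective_map[OF eu \<epsilon>], of p] domA domB
    unfolding quermass by blast
  also have "\<dots> \<le> W"
    unfolding W_def using bodies ball R FB assms(5) by (intro mixed_volume_functional_mono[OF V]) auto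
  finally show False
    by linarith
qed

end
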